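(* $\mathcal{F}_{\mathrm{loc}}=B^{2,\infty}_{\alpha,\beta^*}(K)$, and there exists a constant $C\ge1$ such that for all $u\in\mathcal{F}_{\mathrm{loc}}$ $$\frac1C\,[u]_{B^{2,\infty}_{\alpha,\beta^*}(K)}\le\mathcal{E}_{\mathrm{loc}}(u,u)\le C\,[u]_{B^{2,\infty}_{\alpha,\beta^*}(K)}.$$
   Context: In $\mathbb{R}^2$ let $p_0=(0,0)$, $p_1=(\frac12,0)$, $p_2=(1,0)$, $p_3=(1,\frac12)$, $p_4=(1,1)$, $p_5=(\frac12,1)$, $p_6=(0,1)$, $p_7=(0,\frac12)$, and $f_i(x)=(x+2p_i)/3$ for $i=0,\ldots,7$. The Sierpinski carpet $K$ is the unique non-empty compact set with $K=\bigcup_{i=0}^7 f_i(K)$. Let $\alpha=\log 8/\log 3$ be its Hausdorff dimension and $\nu$ the normalized $\alpha$-dimensional Hausdorff measure on $K$. For $\beta>0$ let $$[u]_{B^{2,\infty}_{\alpha,\beta}(K)}=\sup_{n\ge1}3^{(\alpha+\beta)n}\int_K\int_{\{y\in K:|x-y|<3^{-n}\}}(u(x)-u(y))^2\,\nu(dy)\,\nu(dx),$$ $$B^{2,\infty}_{\alpha,\beta}(K)=\{u\in L^2(K;\nu):[u]_{B^{2,\infty}_{\alpha,\beta}(K)}<+\infty\}.$$ For $\beta>\alpha$ every element of $B^{2,\infty}_{\alpha,\beta}(K)$ has a continuous ($\frac{\beta-\alpha}{2}$-Hölder) version, with which it is identified. Let $V_0=\{p_0,\ldots,p_7\}$. For $n\ge1$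 let $W_n$ be the set of words $w=w_1\ldots w_n$ with $w_i\in\{0,\ldots,7\}$; for $w\in W_n$ put $f_w=f_{w_1}\circ\cdots\circ f_{w_n}$, $V_w=f_w(V_0)$, and let $V_n=\bigcup_{w\in W_n}V_w$. Write $l(V_n)$ for the real functions on $V_n$ and $$D_n(u,u)=\sum_{w\in W_n}\sum_{\substack{p,q\in V_w\\|p-q|=2^{-1}\cdot3^{-n}}}(u(p)-u(q))^2$$ (each unordered pair in $V_w$ counted once). Let $$R_n^V=\left(\inf\{D_n(u,u):u\in l(V_n),\ u=0\text{ on }V_n\cap(\{0\}\times[0,1]),\ u=1\text{ on }V_n\cap(\{1\}\times[0,1])\}\right)^{-1}.$$ The constant $\rho>0$ is the (unique) number for which there is a constant $C\ge1$ with $C^{-1}\rho^n\le R_n^V\le C\rho^n$ for all $n\ge1$; it exists and lies in $[7/6,3/2]$. Put $\beta^*=\log(8\rho)/\log3$, so that $3^{\beta^*-\alpha}=\rho$. $(\mathcal{E}_{\mathrm{loc}},\mathcal{F}_{\mathrm{loc}})$ denotes a strongly local regular Dirichlet form on $L^2(K;\nu)$ (whose existence is established in the paper) which is self-similar, i.e. $u\circ f_i\in\mathcal{F}_{\mathrm{loc}}$ for all $u\in\mathcal{F}_{\mathrm{loc}}$, $i=0,\ldots,7$ and $\mathcal{E}_{\mathrm{loc}}(u,u)=\rho\sum_{i=0}^7\mathcal{E}_{\mathrm{loc}}(u\circ f_i,u\circ f_i)$, and which satisfies $$\mathcal{F}_{\mathrm{loc}}=\{u\in C(K):\sup_{n\ge1}3^{(\beta^*-\alpha)n}D_n(u,u)<+\infty\},\qquad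 C_0^{-1}\mathcal{E}_{\mathrm{loc}}(u,u)\le\sup_{n\ge1}3^{(\beta^*-\alpha)n}D_n(u,u)\le C_0\,\mathcal{E}_{\mathrm{loc}}(u,u)$$ for some constant $C_0\ge1$ and all $u\in\mathcal{F}_{\mathrm{loc}}$ (where $D_n(u,u)$ is evaluated at $u|_{V_n}$). *)

theory Defs
  imports "HOL-Analysis.Analysis"
begin

section \<open>Hausdorff measure\<close>

text \<open>
  Countable covers by sets of diameter at most \<open>\<delta>\<close>. Boundedness is required explicitly because
  \<^const>\<open>diameter\<close> has no meaningful value on unbounded sets. Since \<open>0 powr s = 0\<close> for every \<open>s\<close>, empty
  cover sets cost nothing; the definition is only meant for \<open>s > 0\<close>.
\<close>

definition hausdorff_content :: "real \<Rightarrow> real \<Rightarrow> 'a::metric_space set \<Rightarrow> ennreal" where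
  "hausdorff_content s \<delta> A =
     (INF U \<in> {U :: nat \<Rightarrow> 'a set. (\<forall>i. bounded (U i) \<and> diameter (U i) \<le> \<delta>) \<and> A \<subseteq> (\<Union>i. U i)}.
        \<Sum>i. ennreal (diameter (U i) powr s))"

definition hausdorff_outer :: "real \<Rightarrow> 'a::metric_space set \<Rightarrow> ennreal" where
  "hausdorff_outer s A = (SUP \<delta> \<in> {0<..}. hausdorff_content s \<delta> A)"

definition hausdorff_measure :: "real \<Rightarrow> 'a::metric_space measure" where
  "hausdorff_measure s = measure_of UNIV (sets borel) (hausdorff_outer s)"


section \<open>The Sierpinski carpet\<close>

type_synonym point = "real \<times> real"

definition sc_p :: "nat \<Rightarrow> point" where
  "sc_p i = [(0, 0), (1/2, 0), (1, 0), (1, 1/2), (1, 1), (1/2, 1), (0, 1), (0, 1/2)] ! i"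

definition sc_f :: "nat \<Rightarrow> point \<Rightarrow> point" where
  "sc_f i x = (1/3) *\<^sub>R (x + 2 *\<^sub>R sc_p i)"

definition carpet :: "point set" where
  "carpet = (THE K. compact K \<and> K \<noteq> {} \<and> K = (\<Union>i<8. sc_f i ` K))"

definition sc_alpha :: real where
  "sc_alpha = ln 8 / ln 3"

text \<open>
  The space of \<open>sc_nu\<close> is the carpet itself, so that functions on the carpet are represented by total
  functions on the plane whose values off the carpet play no role.
\<close>

definition sc_nu :: "point measure" where
  "sc_nu = restrict_space (uniform_measure (hausdorff_measure sc_alpha) carpet) carpet"


section \<open>Square-integrable functions and the Besov space\<close>

text \<open>
  Elements of \<open>L\<^sup>2\<close> are handled as functions rather than as almost-everywhere classes; the sets of
  functions below are invariant under almost-everywhere equality.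
\<close>

definition L2_space :: "'a measure \<Rightarrow> ('a \<Rightarrow> real) set" where
  "L2_space M = {u \<in> borel_measurable M. integrable M (\<lambda>x. (u x)\<^sup>2)}"

definition besov_seminorm :: "real \<Rightarrow> (point \<Rightarrow> real) \<Rightarrow> ennreal" where
  "besov_seminorm \<beta> u =
     (SUP n \<in> {1::nat..}. ennreal (3 powr ((sc_alpha + \<beta>) * real n)) *
        (\<integral>\<^sup>+x. (\<integral>\<^sup>+y. ennreal ((u x - u y)\<^sup>2) * indicator (ball x ((1/3) ^ n)) y \<partial>sc_nu) \<partial>sc_nu))"

definition besov_space :: "real \<Rightarrow> (point \<Rightarrow> real) set" where
  "besov_space \<beta> = {u \<in> L2_space sc_nu. besov_seminorm \<beta> u < \<infinity>}"


section \<open>Discrete energies and resistances\<close>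

definition sc_words :: "nat \<Rightarrow> nat list set" where
  "sc_words n = {w. length w = n \<and> set w \<subseteq> {..<8}}"

definition sc_f_word :: "nat list \<Rightarrow> point \<Rightarrow> point" where
  "sc_f_word w = foldr (\<lambda>i g. sc_f i \<circ> g) w id"

definition sc_V_word :: "nat list \<Rightarrow> point set" where
  "sc_V_word w = sc_f_word w ` (sc_p ` {..<8})"

definition sc_V :: "nat \<Rightarrow> point set" where
  "sc_V n = (\<Union>w \<in> sc_words n. sc_V_word w)"

text \<open>The inner sum runs over ordered pairs; the factor \<open>1/2\<close> makes each unordered pair count once.\<close>

definition sc_D :: "nat \<Rightarrow> (point \<Rightarrow> real) \<Rightarrow> real" where
  "sc_D n u =
     (\<Sum>w \<in> sc_words n. 1/2 *
        (\<Sum>(p, q) \<in> {(p, q). p \<in> sc_V_word w \<and> q \<in> sc_V_word w \<and> dist p q = 1/2 * (1/3) ^ n}.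
           (u p - u q)\<^sup>2))"

definition sc_resistance :: "nat \<Rightarrow> real" where
  "sc_resistance n =
     inverse (INF u \<in> {u. (\<forall>p \<in> sc_V n \<inter> ({0} \<times> {0..1}). u p = 0) \<and>
                          (\<forall>p \<in> sc_V n \<inter> ({1} \<times> {0..1}). u p = 1)}. sc_D n u)"

definition resistance_growth :: "real \<Rightarrow> bool" where
  "resistance_growth \<rho> \<longleftrightarrow>
     \<rho> > 0 \<and> (\<exists>C\<ge>1. \<forall>n\<ge>1. inverse C * \<rho> ^ n \<le> sc_resistance n \<and> sc_resistance n \<le> C * \<rho> ^ n)"

definition beta_star :: "real \<Rightarrow> real" where
  "beta_star \<rho> = ln (8 * \<rho>) / ln 3"

definition sup_energy :: "real \<Rightarrow> (point \<Rightarrow> real) \<Rightarrow> ennreal" where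
  "sup_energy \<beta> u = (SUP n \<in> {1::nat..}. ennreal (3 powr ((\<beta> - sc_alpha) * real n) * sc_D n u))"


section \<open>Dirichlet forms\<close>

definition form_1 ::
  "'a measure \<Rightarrow> (('a \<Rightarrow> real) \<Rightarrow> ('a \<Rightarrow> real) \<Rightarrow> real) \<Rightarrow> ('a \<Rightarrow> real) \<Rightarrow> real" where
  "form_1 M E u = E u u + (\<integral>x. (u x)\<^sup>2 \<partial>M)"

locale dirichlet_form =
  fixes M :: "'a measure"
    and F :: "('a \<Rightarrow> real) set"
    and E :: "('a \<Rightarrow> real) \<Rightarrow> ('a \<Rightarrow> real) \<Rightarrow> real"
  assumes domain: "F \<subseteq> L2_space M"
    and domain_AE: "\<lbrakk>u \<in> F; v \<in> borel_measurable M; AE x in M. u x = v x\<rbrakk> \<Longrightarrow> v \<in> F"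
    and form_AE: "\<lbrakk>u \<in> F; v \<in> F; w \<in> F; AE x in M. u x = v x\<rbrakk> \<Longrightarrow> E u w = E v w"
    and domain_linear: "\<lbrakk>u \<in> F; v \<in> F\<rbrakk> \<Longrightarrow> (\<lambda>x. a * u x + b * v x) \<in> F"
    and domain_dense:
      "\<lbrakk>g \<in> L2_space M; \<epsilon> > 0\<rbrakk> \<Longrightarrow> \<exists>u\<in>F. (\<integral>x. (g x - u x)\<^sup>2 \<partial>M) < \<epsilon>"
    and symmetric: "\<lbrakk>u \<in> F; v \<in> F\<rbrakk> \<Longrightarrow> E u v = E v u"
    and linear:
      "\<lbrakk>u \<in> F; v \<in> F; w \<in> F\<rbrakk> \<Longrightarrow> E (\<lambda>x. a * u x + b * v x) w = a * E u w + b * E v w"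
    and nonneg: "u \<in> F \<Longrightarrow> E u u \<ge> 0"
    and closed_form:
      "\<lbrakk>\<And>k. s k \<in> F;
        \<And>\<epsilon>. \<epsilon> > 0 \<Longrightarrow> \<exists>N. \<forall>k\<ge>N. \<forall>l\<ge>N. form_1 M E (\<lambda>x. s k x - s l x) < \<epsilon>\<rbrakk>
       \<Longrightarrow> \<exists>u\<in>F. (\<lambda>k. form_1 M E (\<lambda>x. s k x - u x)) \<longlonglongrightarrow> 0"
    and markovian:
      "u \<in> F \<Longrightarrow> (\<lambda>x. min (max (u x) 0) 1) \<in> F \<and>
         E (\<lambda>x. min (max (u x) 0) 1) (\<lambda>x. min (max (u x) 0) 1) \<le> E u u"

text \<open>
  The state space \<open>X\<close> is taken to be compact, so that \<open>C\<^sub>c(X) = C\<^sub>0(X) = C(X)\<close> in the definition of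
  regularity and the compactness of supports in strong locality is automatic.
\<close>

locale regular_dirichlet_form = dirichlet_form M F E
  for X :: "'a::metric_space set"
    and M :: "'a measure"
    and F :: "('a \<Rightarrow> real) set"
    and E :: "('a \<Rightarrow> real) \<Rightarrow> ('a \<Rightarrow> real) \<Rightarrow> real" +
  assumes compact_space: "compact X" and space_eq: "space M = X"
    and core_dense_form:
      "\<lbrakk>u \<in> F; \<epsilon> > 0\<rbrakk> \<Longrightarrow> \<exists>v\<in>F. continuous_on X v \<and> form_1 M E (\<lambda>x. u x - v x) < \<epsilon>"
    and core_dense_sup:
      "\<lbrakk>continuous_on X g; \<epsilon> > 0\<rbrakk> \<Longrightarrow> \<exists>v\<in>F. continuous_on X v \<and> (\<forall>x\<in>X. \<bar>g x - v x\<bar> < \<epsilon>)"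

text \<open>The support of the measure \<open>\<bar>u\<bar> dM\<close>, the usual notion of support of an \<open>L\<^sup>2\<close> class.\<close>

definition ess_support :: "'a::topological_space measure \<Rightarrow> ('a \<Rightarrow> real) \<Rightarrow> 'a set" where
  "ess_support M u = {x \<in> space M. \<forall>U. open U \<and> x \<in> U \<longrightarrow> \<not> (AE y in M. y \<in> U \<longrightarrow> u y = 0)}"

locale strongly_local_regular_dirichlet_form = regular_dirichlet_form X M F E
  for X :: "'a::metric_space set"
    and M :: "'a measure"
    and F :: "('a \<Rightarrow> real) set"
    and E :: "('a \<Rightarrow> real) \<Rightarrow> ('a \<Rightarrow> real) \<Rightarrow> real" +
  assumes strongly_local:
    "\<lbrakk>u \<in> F; v \<in> F; open G; ess_support M u \<subseteq> G; AE y in M. y \<in> G \<longrightarrow> v y = c\<rbrakk> \<Longrightarrow> E u v = 0"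

definition self_similar_form ::
  "real \<Rightarrow> (point \<Rightarrow> real) set \<Rightarrow> ((point \<Rightarrow> real) \<Rightarrow> (point \<Rightarrow> real) \<Rightarrow> real) \<Rightarrow> bool" where
  "self_similar_form \<rho> F E \<longleftrightarrow>
     (\<forall>u\<in>F. (\<forall>i<8. u \<circ> sc_f i \<in> F) \<and> E u u = \<rho> * (\<Sum>i<8. E (u \<circ> sc_f i) (u \<circ> sc_f i)))"

text \<open>
  The functions with a continuous version \<open>v\<close> satisfying \<open>sup\<^sub>n 3\<^bsup>(\<beta> - \<alpha>) n\<^esup> D\<^sub>n(v, v) < \<infinity>\<close>,
  that is, the almost-everywhere saturation of the set of such continuous \<open>v\<close>.
\<close>

definition energy_domain :: "real \<Rightarrow> (point \<Rightarrow> real) set" where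
  "energy_domain \<beta> =
     {u \<in> L2_space sc_nu. \<exists>v. continuous_on carpet v \<and> (AE x in sc_nu. u x = v x) \<and>
        sup_energy \<beta> v < \<infinity>}"

end

theory Submission
  imports Defs
begin

text \<open>
  Write \<open>K\<^sub>w = f\<^sub>w(K)\<close> for the cell of a word \<open>w\<close>. The exponent \<open>\<beta>\<^sup>*\<close> is chosen so that the two scale factors become
  \<open>3\<^bsup>(\<beta>\<^sup>* - \<alpha>) n\<^esup> = \<rho>\<^sup>n\<close> and \<open>3\<^bsup>(\<alpha> + \<beta>\<^sup>*) n\<^esup> = (64 \<rho>)\<^sup>n\<close>. Since \<open>\<nu>(K\<^sub>w) = 8\<^sup>-\<^sup>n\<close> for a word of length \<open>n\<close>, integrating
  \<open>(u(x) - u(y))\<^sup>2\<close> over pairs at distance below \<open>3\<^sup>-\<^sup>n\<close> amounts to \<open>64\<^sup>-\<^sup>n\<close> times a sum of squared differences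
  between neighbouring cells, which is what \<open>D\<^sub>n\<close> measures. The theorem therefore follows from the equivalence,
  for continuous \<open>v\<close>, of \<open>sup\<^sub>n \<rho>\<^sup>n D\<^sub>n(v)\<close> and the Besov seminorm, together with the fact that every
  function of finite seminorm has a continuous version; the form \<open>E\<close> is comparable with
  \<open>sup\<^sub>n \<rho>\<^sup>n D\<^sub>n\<close> on continuous functions, and does not change under modification on null sets.

  From \<open>D\<^sub>n\<close> to the seminorm (\<open>besov_seminorm_le_sup_energy\<close>): two points closer than \<open>3\<^sup>-\<^sup>n\<close> lie in cells of level \<open>n\<close>
  whose squares touch, and touching squares share one of the points of \<open>V\<^sub>n\<close>. So \<open>v(x) - v(y)\<close> splits into the
  difference of the values at the two corners \<open>f\<^sub>w(p\<^sub>0)\<close>, controlled by \<open>D\<^sub>n\<close>, and the deviations of \<open>v\<close> from these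
  corner values. The total squared deviation \<open>\<Phi>\<^sub>n = \<Sum>\<^sub>w \<integral>\<^bsub>K\<^sub>w\<^esub> (v - v(f\<^sub>w(p\<^sub>0)))\<^sup>2 d\<nu>\<close> satisfies
  \<open>\<surd>\<Phi>\<^sub>n \<le> \<surd>\<Phi>\<^sub>n\<^sub>+\<^sub>1 + c (8 \<rho>)\<^bsup>-n/2\<^esup>\<close> and tends to \<open>0\<close>, hence is of order \<open>(8 \<rho>)\<^sup>-\<^sup>n\<close>.

  From the seminorm to \<open>D\<^sub>n\<close> (\<open>sup_energy_le_besov_seminorm\<close>): averages of \<open>v\<close> over nearby cells differ by an amount that
  Jensen's inequality bounds by the near-diagonal integral. The value \<open>v(f\<^sub>w(p\<^sub>i))\<close> is the limit of the averages over
  \<open>K\<^bsub>w i\<^esub>, K\<^bsub>w i i\<^esub>, \<dots>\<close>, because \<open>p\<^sub>i\<close> is the fixed point of \<open>f\<^sub>i\<close>, and the increments sum up geometrically in \<open>\<rho>\<^bsup>-1/2\<^esup>\<close>.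
  The same estimate makes the averages along shrinking cells converge uniformly for an arbitrary \<open>u\<close> of finite
  seminorm; the limit is the continuous version (\<open>besov_continuous_version\<close>).

  The masses \<open>\<nu>(K\<^sub>w) = 8\<^sup>-\<^sup>n\<close> are obtained as follows. If the Hausdorff measure of \<open>K\<close> is positive and finite, they follow
  from its scaling under similarities. The remaining case of the definition is that \<open>\<nu>\<close> is the null measure, where all
  functions agree almost everywhere and both seminorms and the form vanish identically.
\<close>

section \<open>Elementary inequalities\<close>

lemma weighted_square_sum:
  fixes a b t :: real
  assumes "t > 0"
  shows "(a + b)\<^sup>2 \<le> (1 + t) * a\<^sup>2 + (1 + 1 / t) * b\<^sup>2"
proof -
  have "0 \<le> (t * a - b)\<^sup>2 / t" using assms by simp
  also have "\<dots> = (1 + t) * a\<^sup>2 + (1 + 1 / t) * b\<^sup>2 - (a + b)\<^sup>2"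
    using assms by (simp add: power2_eq_square field_simps)
  finally show ?thesis by simp
qed

text \<open>
  Minkowski's inequality in disguise: minimising the right-hand side over \<open>t\<close> gives \<open>(\<surd>y + \<surd>z)\<^sup>2\<close>. Used for \<open>L\<^sup>2\<close> norms
  that are sums of integrals over cells, where the weighted form is what a pointwise estimate provides.
\<close>

lemma sqrt_le_of_weighted:
  fixes x y z :: real
  assumes "0 \<le> y" "0 \<le> z" and le: "\<And>t. t > 0 \<Longrightarrow> x \<le> (1 + t) * y + (1 + 1 / t) * z"
  shows "sqrt x \<le> sqrt y + sqrt z"
proof -
  \<comment> \<open>the optimal weight needs \<open>y, z > 0\<close>, hence the perturbation by \<open>e\<close>\<close>
  have "sqrt x \<le> sqrt (y + e) + sqrt (z + e)" if e: "e > 0" for e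
  proof -
    define t where "t = sqrt (z + e) / sqrt (y + e)"
    have pos: "0 < sqrt (z + e)" "0 < sqrt (y + e)" using assms e by auto
    have t: "t > 0" using pos by (simp add: t_def)
    have "x \<le> (1 + t) * y + (1 + 1 / t) * z" using le t .
    also have "\<dots> \<le> (1 + t) * (sqrt (y + e))\<^sup>2 + (1 + 1 / t) * (sqrt (z + e))\<^sup>2"
      using assms e t by (intro add_mono mult_left_mono) auto
    also have "\<dots> = (sqrt (y + e) + sqrt (z + e))\<^sup>2"
      using pos unfolding t_def by (simp add: field_simps power2_eq_square)
    finally show ?thesis using pos by (intro real_le_lsqrt) auto
  qed
  then have ev: "\<forall>\<^sub>F e in at_right 0. sqrt x \<le> sqrt (y + e) + sqrt (z + e)"
    by (simp add: eventually_at_right_less eventually_mono[OF eventually_at_right_less])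
  have "((\<lambda>e. sqrt (y + e) + sqrt (z + e)) \<longlongrightarrow> sqrt (y + 0) + sqrt (z + 0)) (at_right 0)"
    by (intro tendsto_intros)
  from tendsto_lowerbound[OF this ev] show ?thesis by simp
qed

text \<open>
  Telescoping to infinity: subtracting the tail \<open>c q\<^sup>n / (1 - q)\<close> of the geometric series turns the recursion into
  monotonicity, so the limit \<open>0\<close> is an upper bound.
\<close>

lemma geometric_telescope_bound:
  fixes a :: "nat \<Rightarrow> real"
  assumes step: "\<And>k. a k \<le> a (Suc k) + c * q ^ k"
    and q: "0 \<le> q" "q < 1" and lim: "a \<longlonglongrightarrow> 0"
  shows "a n \<le> c * q ^ n / (1 - q)"
proof -
  let ?b = "\<lambda>k. a k - c * q ^ k / (1 - q)"
  have "incseq ?b"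
  proof (rule incseq_SucI)
    fix k
    have "c * q ^ k / (1 - q) = c * q ^ k + c * q ^ Suc k / (1 - q)"
      using q by (simp add: field_simps)
    then show "?b k \<le> ?b (Suc k)" using step[of k] by simp
  qed
  moreover have "?b \<longlonglongrightarrow> 0 - c * 0 / (1 - q)"
    using q by (intro tendsto_intros lim LIMSEQ_realpow_zero) auto
  ultimately have "?b n \<le> 0 - c * 0 / (1 - q)" by (rule incseq_le)
  then show ?thesis by simp
qed

lemma square_sum3_le: "(a + b + c)\<^sup>2 \<le> 3 * a\<^sup>2 + 3 * b\<^sup>2 + 3 * c\<^sup>2" for a b c :: real
  using sum_squares_bound[of a b] sum_squares_bound[of a c] sum_squares_bound[of b c]
  by (simp add: power2_eq_square algebra_simps)

text \<open>
  The eight points \<open>p\<^sub>0, \<dots>, p\<^sub>7\<close> and the eight subcells of a cell are chained in cyclic order, so any two of them are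
  at most seven steps apart.
\<close>

lemma square_telescope_le:
  fixes g :: "nat \<Rightarrow> real"
  assumes "\<And>k. Suc k < 8 \<Longrightarrow> (g k - g (Suc k))\<^sup>2 \<le> e" "i < 8" "j < 8"
  shows "(g i - g j)\<^sup>2 \<le> 49 * e"
proof -
  have "0 \<le> (g 0 - g (Suc 0))\<^sup>2" by simp
  also have "\<dots> \<le> e" using assms(1)[of 0] by simp
  finally have e: "0 \<le> e" .
  have *: "\<bar>g i - g (i + m)\<bar> \<le> real m * sqrt e" if "i + m < 8" for i m
    using that
  proof (induction m)
    case (Suc m)
    have "\<bar>g (i + m) - g (Suc (i + m))\<bar> \<le> sqrt e"
      using assms(1)[of "i + m"] Suc.prems by (simp add: real_le_rsqrt)
    then show ?case using Suc by (simp add: algebra_simps)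
  qed simp
  have **: "\<bar>g i - g j\<bar> \<le> 7 * sqrt e" if "i \<le> j" "j < 8" for i j
  proof -
    have "\<bar>g i - g j\<bar> \<le> real (j - i) * sqrt e" using *[of i "j - i"] that by simp
    also have "\<dots> \<le> 7 * sqrt e" using that e by (intro mult_right_mono) auto
    finally show ?thesis .
  qed
  have "\<bar>g i - g j\<bar> \<le> 7 * sqrt e"
    using **[of i j] **[of j i] assms(2,3) by (cases "i \<le> j") (auto simp: abs_minus_commute)
  then have "(g i - g j)\<^sup>2 \<le> (7 * sqrt e)\<^sup>2"
    by (metis abs_ge_zero power_mono power2_abs)
  then show ?thesis using e by (simp add: power_mult_distrib)
qed

section \<open>Words and the grid of cells\<close>

lemma sc_f_word_Nil [simp]: "sc_f_word [] = id"
  and sc_f_word_Cons: "sc_f_word (i # w) = sc_f i \<circ> sc_f_word w"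
  by (simp_all add: sc_f_word_def)

lemma sc_f_word_append: "sc_f_word (v @ w) = sc_f_word v \<circ> sc_f_word w"
  by (induction v) (simp_all add: sc_f_word_Cons comp_assoc)

lemma sc_f_word_snoc: "sc_f_word (w @ [i]) x = sc_f_word w (sc_f i x)"
  by (simp add: sc_f_word_append sc_f_word_Cons)

text \<open>
  The lower left corner of the square with index \<open>i\<close> in the \<open>3 \<times> 3\<close> grid, that is \<open>2 p\<^sub>i\<close>. With these digits the map of a
  word becomes a dilation followed by the translation whose coordinates are read off in base 3.
\<close>

definition digit :: "nat \<Rightarrow> nat \<times> nat" where
  "digit i = [(0, 0), (1, 0), (2, 0), (2, 1), (2, 2), (1, 2), (0, 2), (0, 1)] ! i"

lemma less_8_cases: "i < 8 \<Longrightarrow> i \<in> {0, 1, 2, 3, 4, 5, 6, 7::nat}"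
  by auto

lemma sc_p_digit: "i < 8 \<Longrightarrow> 2 *\<^sub>R sc_p i = (real (fst (digit i)), real (snd (digit i)))"
  using less_8_cases[of i] by (auto simp: sc_p_def digit_def)

lemma digit_le: "i < 8 \<Longrightarrow> fst (digit i) \<le> 2 \<and> snd (digit i) \<le> 2"
  using less_8_cases[of i] by (auto simp: digit_def)

lemma inj_on_digit: "inj_on digit {..<8}"
proof (rule inj_onI)
  fix i j :: nat assume "i \<in> {..<8}" "j \<in> {..<8}" "digit i = digit j"
  then show "i = j"
    using less_8_cases[of i] less_8_cases[of j] by (auto simp: digit_def)
qed

lemma digit_Suc:
  assumes "Suc i < 8"
  shows "\<bar>int (fst (digit i)) - int (fst (digit (Suc i)))\<bar> \<le> 1 \<and>
         \<bar>int (snd (digit i)) - int (snd (digit (Suc i)))\<bar> \<le> 1"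
proof -
  have "i \<in> {0, 1, 2, 3, 4, 5, 6}" using assms by auto
  then show ?thesis by (auto simp: digit_def)
qed

definition pos_x :: "nat list \<Rightarrow> nat" where
  "pos_x w = foldl (\<lambda>a i. 3 * a + fst (digit i)) 0 w"

definition pos_y :: "nat list \<Rightarrow> nat" where
  "pos_y w = foldl (\<lambda>a i. 3 * a + snd (digit i)) 0 w"

lemma pos_snoc [simp]:
  "pos_x [] = 0" "pos_y [] = 0"
  "pos_x (w @ [i]) = 3 * pos_x w + fst (digit i)"
  "pos_y (w @ [i]) = 3 * pos_y w + snd (digit i)"
  by (simp_all add: pos_x_def pos_y_def)

lemma sc_words_0 [simp]: "sc_words 0 = {[]}"
  by (auto simp: sc_words_def)

lemma sc_words_snocI: "w \<in> sc_words n \<Longrightarrow> i < 8 \<Longrightarrow> w @ [i] \<in> sc_words (Suc n)"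
  by (auto simp: sc_words_def)

lemma sc_words_SucE:
  assumes "w \<in> sc_words (Suc n)"
  obtains v i where "w = v @ [i]" "v \<in> sc_words n" "i < 8"
  using assms by (cases w rule: rev_cases) (auto simp: sc_words_def)

lemma sc_words_Suc: "sc_words (Suc n) = (\<lambda>(w, i). w @ [i]) ` (sc_words n \<times> {..<8})"
  by (auto elim!: sc_words_SucE intro: sc_words_snocI)

lemma finite_sc_words [simp]: "finite (sc_words n)"
  by (induction n) (simp_all add: sc_words_Suc)

lemma sum_sc_words_Suc:
  fixes g :: "nat list \<Rightarrow> 'a::comm_monoid_add"
  shows "(\<Sum>w\<in>sc_words (Suc n). g w) = (\<Sum>w\<in>sc_words n. \<Sum>i<8. g (w @ [i]))"
proof -
  have "inj_on (\<lambda>(w, i). w @ [i]) (sc_words n \<times> {..<8})"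
    by (auto simp: inj_on_def)
  then show ?thesis
    by (simp add: sc_words_Suc sum.reindex sum.cartesian_product case_prod_unfold)
qed

lemma card_sc_words: "card (sc_words n) = 8 ^ n"
proof -
  have "(\<Sum>w\<in>sc_words n. 1) = (8 ^ n :: nat)"
    by (induction n) (simp_all add: sum_sc_words_Suc del: sum_constant, simp)
  then show ?thesis by simp
qed

lemma length_sc_words: "w \<in> sc_words n \<Longrightarrow> length w = n"
  by (simp add: sc_words_def)

text \<open>
  A cell of level \<open>n\<close> lies in the square of side \<open>3\<^sup>-\<^sup>n\<close> at an integer position. All incidence questions about cells
  become questions about integers through this formula.
\<close>

lemma sc_f_word_affine:
  assumes "w \<in> sc_words n"
  shows "sc_f_word w x = (1/3) ^ n *\<^sub>R (x + (real (pos_x w), real (pos_y w)))"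
  using assms
proof (induction n arbitrary: w x)
  case 0
  then show ?case by (cases x) simp
next
  case (Suc n)
  then obtain v i where w: "w = v @ [i]" "v \<in> sc_words n" "i < 8"
    by (elim sc_words_SucE)
  have "sc_f i x = (1/3) *\<^sub>R (x + (real (fst (digit i)), real (snd (digit i))))"
    using w(3) by (simp add: sc_f_def sc_p_digit)
  then show ?case
    using w Suc.IH[OF w(2)] by (cases x) (simp add: sc_f_word_snoc field_simps)
qed

lemma dist_sc_f_word:
  assumes "w \<in> sc_words n"
  shows "dist (sc_f_word w x) (sc_f_word w y) = (1/3) ^ n * dist x y"
  using sc_f_word_affine[OF assms] by (simp add: dist_norm flip: scaleR_diff_right)

lemma dist_sc_f: "dist (sc_f i x) (sc_f i y) = 1/3 * dist x y"
  by (simp add: sc_f_def dist_norm flip: scaleR_diff_right)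

lemma inj_sc_f_word: "w \<in> sc_words n \<Longrightarrow> inj (sc_f_word w)"
  by (rule injI) (metis dist_sc_f_word dist_eq_0_iff mult_eq_0_iff power_eq_0_iff
      divide_eq_0_iff zero_neq_one zero_neq_numeral)

text \<open>
  Uniqueness of base 3 expansions: the last digits are the residues modulo 3, and the eight digit pairs are distinct.
\<close>

lemma inj_on_pos: "inj_on (\<lambda>w. (pos_x w, pos_y w)) (sc_words n)"
proof (induction n)
  case (Suc n)
  show ?case
  proof (rule inj_onI)
    fix w w' assume *: "w \<in> sc_words (Suc n)" "w' \<in> sc_words (Suc n)"
      "(pos_x w, pos_y w) = (pos_x w', pos_y w')"
    obtain v i where w: "w = v @ [i]" "v \<in> sc_words n" "i < 8"
      using *(1) by (elim sc_words_SucE)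
    obtain v' j where w': "w' = v' @ [j]" "v' \<in> sc_words n" "j < 8"
      using *(2) by (elim sc_words_SucE)
    have eq: "3 * pos_x v + fst (digit i) = 3 * pos_x v' + fst (digit j)"
      "3 * pos_y v + snd (digit i) = 3 * pos_y v' + snd (digit j)"
      using *(3) w w' by simp_all
    moreover have "a = a'" if "3 * a + d = 3 * a' + d'" "d \<le> 2" "d' \<le> 2" for a a' d d' :: nat
      using that by linarith
    ultimately have "pos_x v = pos_x v'" "pos_y v = pos_y v'"
      using digit_le[OF w(3)] digit_le[OF w'(3)] by blast+
    moreover from this have "digit i = digit j"
      using eq by (simp add: prod_eq_iff)
    ultimately show "w = w'"
      using w w' Suc.IH inj_on_digit by (auto simp: inj_on_def)
  qed
qed simp

section \<open>The carpet\<close>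

lemma sc_p_unit: "i < 8 \<Longrightarrow> sc_p i \<in> {0..1} \<times> {0..1}"
  using less_8_cases[of i] by (auto simp: sc_p_def)

lemma sc_f_unit: "x \<in> {0..1} \<times> {0..1} \<Longrightarrow> i < 8 \<Longrightarrow> sc_f i x \<in> {0..1} \<times> {0..1}"
  using sc_p_unit[of i] by (auto simp: sc_f_def mem_Times_iff)

lemma sc_f_fixed: "sc_f i (sc_p i) = sc_p i"
  by (simp add: sc_f_def prod_eq_iff)

lemma continuous_sc_f [continuous_intros]: "continuous_on S (sc_f i)"
  unfolding sc_f_def by (intro continuous_intros)

lemma sc_V_Suc: "sc_V (Suc n) = (\<Union>i<8. sc_f i ` sc_V n)"
proof -
  have "sc_words (Suc n) = (\<Union>i<8. (#) i ` sc_words n)"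
    by (auto simp: sc_words_def length_Suc_conv)
  moreover have "sc_V_word (i # w) = sc_f i ` sc_V_word w" for i w
    by (simp add: sc_V_word_def sc_f_word_Cons image_comp)
  ultimately show ?thesis
    by (auto simp: sc_V_def)
qed

lemma sc_V_0: "sc_V 0 = sc_p ` {..<8}"
  by (simp add: sc_V_def sc_V_word_def)

lemma sc_V_unit: "sc_V n \<subseteq> {0..1} \<times> {0..1}"
proof (induction n)
  case 0
  show ?case unfolding sc_V_0 by (intro image_subsetI sc_p_unit) simp
next
  case (Suc n)
  then show ?case using sc_f_unit unfolding sc_V_Suc by blast
qed

text \<open>
  The distance to \<open>L\<close> attains its maximum on \<open>K\<close>; the maximising point is the image of a point of \<open>K\<close> under some \<open>f\<^sub>i\<close>,
  which divides distances by 3, so the maximum is at most a third of itself.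
\<close>

lemma invariant_compact_subset:
  assumes K: "compact K" "K \<noteq> {}" "K \<subseteq> (\<Union>i<8. sc_f i ` K)"
    and L: "compact L" "L \<noteq> {}" "(\<Union>i<8. sc_f i ` L) \<subseteq> L"
  shows "K \<subseteq> L"
proof -
  have "continuous_on K (\<lambda>x. infdist x L)" by (intro continuous_intros)
  then obtain x where x: "x \<in> K" "\<And>y. y \<in> K \<Longrightarrow> infdist y L \<le> infdist x L"
    using continuous_attains_sup[OF K(1,2)] by blast
  obtain i y where y: "i < 8" "y \<in> K" "x = sc_f i y"
    using x(1) K(3) by blast
  obtain z where z: "z \<in> L" "infdist y L = dist y z"
    using infdist_attains_inf[OF compact_imp_closed[OF L(1)] L(2)] by blast
  have "sc_f i z \<in> L" using L(3) y(1) z(1) by blast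
  then have "infdist x L \<le> dist x (sc_f i z)" by (rule infdist_le)
  also have "\<dots> = 1/3 * infdist y L" using y z by (simp add: dist_sc_f)
  also have "\<dots> \<le> 1/3 * infdist x L" using x(2)[OF y(2)] by simp
  finally have "infdist x L \<le> 0" by simp
  then have "\<And>y. y \<in> K \<Longrightarrow> infdist y L = 0"
    using x(2) infdist_nonneg[of _ L] by (meson order.antisym order.trans)
  then show ?thesis
    using in_closed_iff_infdist_zero[OF compact_imp_closed[OF L(1)] L(2)] by blast
qed

text \<open>
  The union of all \<open>V\<^sub>n\<close> is reproduced by the eight maps because the points of \<open>V\<^sub>0\<close> are their fixed points; passing
  to the closure gives the compact invariant set.
\<close>

lemma carpet_eq_closure: "carpet = closure (\<Union>n. sc_V n)"
  and compact_carpet: "compact carpet"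
  and carpet_invariant: "carpet = (\<Union>i<8. sc_f i ` carpet)"
proof -
  define A where "A = (\<Union>n. sc_V n)"
  have sub: "A \<subseteq> cbox (0, 0) (1, 1)"
    using sc_V_unit unfolding A_def cbox_Pair_eq by auto
  then have comp: "compact (closure A)"
    using bounded_subset[OF bounded_cbox] by (auto intro: compact_closure[THEN iffD2])
  have A: "A = (\<Union>i<8. sc_f i ` A)"
  proof
    show "(\<Union>i<8. sc_f i ` A) \<subseteq> A"
      unfolding A_def using sc_V_Suc by (auto; blast)
    have "sc_V 0 \<subseteq> sc_V (Suc 0)"
      using sc_f_fixed by (force simp: sc_V_Suc sc_V_0)
    then have "sc_V n \<subseteq> (\<Union>i<8. sc_f i ` A)" for n
      by (cases n) (auto simp: sc_V_Suc A_def; blast)+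
    then show "A \<subseteq> (\<Union>i<8. sc_f i ` A)"
      unfolding A_def by blast
  qed
  have cl: "closure (sc_f i ` A) = sc_f i ` closure A" for i
  proof
    have "closed (sc_f i ` closure A)"
      by (intro compact_imp_closed compact_continuous_image continuous_sc_f comp)
    then show "closure (sc_f i ` A) \<subseteq> sc_f i ` closure A"
      by (simp add: closure_minimal closure_subset image_mono)
    show "sc_f i ` closure A \<subseteq> closure (sc_f i ` A)"
      by (rule image_closure_subset[OF continuous_sc_f]) (simp_all add: closure_subset)
  qed
  have inv: "closure A = (\<Union>i<8. sc_f i ` closure A)"
  proof -
    have "closure A = closure (\<Union>i<8. sc_f i ` A)" using A by simp
    also have "\<dots> = (\<Union>i<8. closure (sc_f i ` A))"
    proof
      show "closure (\<Union>i<8. sc_f i ` A) \<subseteq> (\<Union>i<8. closure (sc_f i ` A))"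
        by (intro closure_minimal closed_UN UN_mono closure_subset) auto
      show "(\<Union>i<8. closure (sc_f i ` A)) \<subseteq> closure (\<Union>i<8. sc_f i ` A)"
        by (intro UN_least closure_mono) blast
    qed
    finally show ?thesis using cl by simp
  qed
  have ne: "closure A \<noteq> {}"
    unfolding A_def using sc_V_0 by (auto intro!: exI[of _ 0] simp: lessThan_empty_iff)
  have "carpet = closure A"
    unfolding carpet_def
  proof (rule the_equality)
    show "compact (closure A) \<and> closure A \<noteq> {} \<and> closure A = (\<Union>i<8. sc_f i ` closure A)"
      using comp ne inv by blast
    fix K assume K: "compact K \<and> K \<noteq> {} \<and> K = (\<Union>i<8. sc_f i ` K)"
    then have "K \<subseteq> (\<Union>i<8. sc_f i ` K)" "(\<Union>i<8. sc_f i ` K) \<subseteq> K"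
      using equalityD1 equalityD2 by (metis (no_types, lifting) order_refl)+
    with K show "K = closure A"
      using invariant_compact_subset[of K "closure A"] invariant_compact_subset[of "closure A" K]
        comp ne equalityD1[OF inv] equalityD2[OF inv] by (meson subset_antisym)
  qed
  then show "carpet = closure (\<Union>n. sc_V n)" "compact carpet" "carpet = (\<Union>i<8. sc_f i ` carpet)"
    using comp inv by (simp_all add: A_def)
qed

lemma carpet_unit: "carpet \<subseteq> {0..1} \<times> {0..1}"
  unfolding carpet_eq_closure
  by (rule closure_minimal) (use sc_V_unit in \<open>auto intro!: closed_Times\<close>)

lemma sc_p_carpet: "i < 8 \<Longrightarrow> sc_p i \<in> carpet"
  using closure_subset[of "\<Union>n. sc_V n"] by (auto simp: carpet_eq_closure sc_V_0 intro!: subsetD[OF closure_subset] exI[of _ 0])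

definition cell :: "nat list \<Rightarrow> point set" where
  "cell w = sc_f_word w ` carpet"

lemma cell_Nil [simp]: "cell [] = carpet"
  by (simp add: cell_def)

lemma cell_split: "cell w = (\<Union>i<8. cell (w @ [i]))"
proof -
  have "cell w = sc_f_word w ` (\<Union>i<8. sc_f i ` carpet)"
    unfolding cell_def using carpet_invariant by simp
  then show ?thesis
    by (simp add: cell_def image_UN image_image sc_f_word_snoc)
qed

lemma carpet_eq_cells: "carpet = (\<Union>w\<in>sc_words n. cell w)"
proof (induction n)
  case (Suc n)
  have "(\<Union>w\<in>sc_words (Suc n). cell w) = (\<Union>w\<in>sc_words n. \<Union>i<8. cell (w @ [i]))"
    unfolding sc_words_Suc by fastforce
  also have "\<dots> = (\<Union>w\<in>sc_words n. cell w)" by (simp flip: cell_split)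
  finally show ?case using Suc.IH by simp
qed simp

lemma cell_subset: "w \<in> sc_words n \<Longrightarrow> cell w \<subseteq> carpet"
  using carpet_eq_cells by blast

lemma continuous_sc_f_word: "w \<in> sc_words n \<Longrightarrow> continuous_on S (sc_f_word w)"
  by (subst continuous_on_cong[OF refl sc_f_word_affine]) (auto intro!: continuous_intros)

lemma compact_cell: "w \<in> sc_words n \<Longrightarrow> compact (cell w)"
  unfolding cell_def by (intro compact_continuous_image compact_carpet continuous_sc_f_word)

lemma sc_f_word_in_cell: "x \<in> carpet \<Longrightarrow> sc_f_word w x \<in> cell w"
  by (simp add: cell_def)

text \<open>
  The constant \<open>3/2\<close> is a convenient rational bound for \<open>\<surd>2\<close>; what matters later is that it is below 2, so that not only
  the diameter of a cell of level \<open>n + 1\<close> but also that of two adjacent ones together is less than \<open>3\<^sup>-\<^sup>n\<close>.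
\<close>

lemma dist_carpet: 
  assumes "x \<in> carpet" "y \<in> carpet" shows "dist x y \<le> 3/2"
proof -
  have "\<bar>fst x - fst y\<bar> \<le> 1" "\<bar>snd x - snd y\<bar> \<le> 1"
    using assms[THEN subsetD[OF carpet_unit]] by (auto simp: mem_Times_iff abs_le_iff)
  then have "(fst x - fst y)\<^sup>2 + (snd x - snd y)\<^sup>2 \<le> 1 + 1"
    by (intro add_mono) (simp_all add: abs_square_le_1)
  also have "\<dots> \<le> (3/2)\<^sup>2" by (simp add: power2_eq_square)
  finally show ?thesis
    unfolding dist_prod_def dist_real_def by (intro real_le_lsqrt) simp_all
qed

lemma dist_cell:
  assumes "w \<in> sc_words n" "x \<in> cell w" "y \<in> cell w"
  shows "dist x y \<le> 3/2 * (1/3) ^ n"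
  using assms dist_carpet by (auto simp: cell_def dist_sc_f_word)

section \<open>Energies of single cells\<close>

definition cell_energy :: "nat list \<Rightarrow> (point \<Rightarrow> real) \<Rightarrow> real" where
  "cell_energy w u = 1/2 * (\<Sum>(i, j) \<in> {(i, j). i < 8 \<and> j < 8 \<and> dist (sc_p i) (sc_p j) = 1/2}.
     (u (sc_f_word w (sc_p i)) - u (sc_f_word w (sc_p j)))\<^sup>2)"

lemma inj_on_sc_p: "inj_on sc_p {..<8}"
proof (rule inj_onI)
  fix i j :: nat assume *: "i \<in> {..<8}" "j \<in> {..<8}" "sc_p i = sc_p j"
  then have "digit i = digit j" 
    using sc_p_digit[of i] sc_p_digit[of j] by (simp add: prod_eq_iff)
  then show "i = j" using * inj_on_digit by (auto simp: inj_on_def)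
qed

lemma finite_neighbour_pairs [simp]: "finite {(i, j). i < (8::nat) \<and> j < (8::nat) \<and> P i j}"
  by (rule finite_subset[of _ "{..<8} \<times> {..<8}"]) auto

lemma sc_D_eq: "sc_D n u = (\<Sum>w\<in>sc_words n. cell_energy w u)"
  unfolding sc_D_def
proof (rule sum.cong[OF refl])
  fix w assume w: "w \<in> sc_words n"
  let ?h = "\<lambda>(i, j). (sc_f_word w (sc_p i), sc_f_word w (sc_p j))"
  let ?P = "{(i, j). i < 8 \<and> j < 8 \<and> dist (sc_p i) (sc_p j) = 1/2}"
  have p_eq: "i = j" if "sc_f_word w (sc_p i) = sc_f_word w (sc_p j)" "i < 8" "j < 8" for i j
    using that injD[OF inj_sc_f_word[OF w]] inj_onD[OF inj_on_sc_p] by blast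
  have inj: "inj_on ?h ?P"
  proof (rule inj_onI)
    fix a b assume "a \<in> ?P" "b \<in> ?P" "?h a = ?h b"
    then show "a = b"
      using p_eq[of "fst a" "fst b"] p_eq[of "snd a" "snd b"] by (auto simp: case_prod_unfold prod_eq_iff)
  qed
  have d: "dist (sc_f_word w (sc_p i)) (sc_f_word w (sc_p j)) = 1/2 * (1/3) ^ n \<longleftrightarrow> dist (sc_p i) (sc_p j) = 1/2" for i j
    unfolding dist_sc_f_word[OF w] by (simp add: field_simps)
  have "{(p, q). p \<in> sc_V_word w \<and> q \<in> sc_V_word w \<and> dist p q = 1/2 * (1/3) ^ n} = ?h ` ?P"
    (is "?L = _")
  proof
    show "?L \<subseteq> ?h ` ?P"
    proof
      fix z assume "z \<in> ?L"
      then obtain p q where z: "z = (p, q)" "p \<in> sc_V_word w" "q \<in> sc_V_word w" "dist p q = 1/2 * (1/3) ^ n"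
        by blast
      obtain i where i: "i < 8" "p = sc_f_word w (sc_p i)"
        using z(2) unfolding sc_V_word_def by blast
      obtain j where j: "j < 8" "q = sc_f_word w (sc_p j)"
        using z(3) unfolding sc_V_word_def by blast
      have "(i, j) \<in> ?P" using z(4) i j d by simp
      then show "z \<in> ?h ` ?P"
        using z(1) i(2) j(2) by (intro image_eqI[of _ _ "(i, j)"]) simp_all
    qed
    show "?h ` ?P \<subseteq> ?L"
    proof (rule image_subsetI)
      fix x assume x: "x \<in> ?P"
      obtain i j where ij: "x = (i, j)" by (cases x)
      have "i < 8" "j < 8" "dist (sc_p i) (sc_p j) = 1/2" using x by (simp_all add: ij)
      then show "?h x \<in> ?L"
        unfolding ij split mem_Collect_eq sc_V_word_def by (intro conjI imageI d[THEN iffD2]) simp_all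
    qed
  qed
  then have "(\<Sum>(p, q) \<in> {(p, q). p \<in> sc_V_word w \<and> q \<in> sc_V_word w \<and> dist p q = 1/2 * (1/3) ^ n}. (u p - u q)\<^sup>2)
      = (\<Sum>(p, q) \<in> ?h ` ?P. (u p - u q)\<^sup>2)" by (rule arg_cong)
  also have "\<dots> = (\<Sum>(i, j)\<in>?P. (u (sc_f_word w (sc_p i)) - u (sc_f_word w (sc_p j)))\<^sup>2)"
    by (subst sum.reindex[OF inj]) (intro sum.cong refl, simp add: case_prod_unfold)
  finally show "1/2 * (\<Sum>(p, q) \<in> {(p, q). p \<in> sc_V_word w \<and> q \<in> sc_V_word w \<and> dist p q = 1/2 * (1/3) ^ n}.
           (u p - u q)\<^sup>2) = cell_energy w u"
    by (simp only: cell_energy_def)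
qed

lemma cell_energy_nonneg: "0 \<le> cell_energy w u"
  unfolding cell_energy_def by (auto intro!: sum_nonneg)

lemma sc_D_nonneg: "0 \<le> sc_D n u"
  by (simp add: sc_D_eq sum_nonneg cell_energy_nonneg)

lemma dist_sc_p_Suc: "Suc i < 8 \<Longrightarrow> dist (sc_p i) (sc_p (Suc i)) = 1/2"
proof -
  assume "Suc i < 8"
  then have "i \<in> {0, 1, 2, 3, 4, 5, 6}" by auto
  then show ?thesis by (auto simp: sc_p_def dist_prod_def dist_real_def real_sqrt_divide)
qed

text \<open>
  Consecutive points of the cycle \<open>p\<^sub>0, \<dots>, p\<^sub>7\<close> are at distance \<open>1/2\<close>, so the differences along the cycle occur in
  the energy of the cell.
\<close>

lemma cell_energy_vertices:
  assumes "i < 8" "j < 8"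
  shows "(u (sc_f_word w (sc_p i)) - u (sc_f_word w (sc_p j)))\<^sup>2 \<le> 98 * cell_energy w u"
proof -
  have "(u (sc_f_word w (sc_p k)) - u (sc_f_word w (sc_p (Suc k))))\<^sup>2 \<le> 2 * cell_energy w u"
    if "Suc k < 8" for k
  proof -
    let ?f = "\<lambda>(i, j). (u (sc_f_word w (sc_p i)) - u (sc_f_word w (sc_p j)))\<^sup>2"
    have "?f (k, Suc k) \<le> sum ?f {(i, j). i < 8 \<and> j < 8 \<and> dist (sc_p i) (sc_p j) = 1/2}"
      by (rule member_le_sum) (use that dist_sc_p_Suc[OF that] in auto)
    then show ?thesis by (simp add: cell_energy_def)
  qed
  from square_telescope_le[where g = "\<lambda>k. u (sc_f_word w (sc_p k))", OF this assms] show ?thesis by simp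
qed

text \<open>
  Why the subcells of adjacent points are close: \<open>(3/2 + 2 \<cdot> 1/2) / 3 < 1\<close>.
\<close>

lemma adjacent_children_near:
  assumes w: "w \<in> sc_words n" and ij: "i < 8" "j < 8" "dist (sc_p i) (sc_p j) = 1/2"
    and x: "x \<in> cell (w @ [i])" "y \<in> cell (w @ [j])"
  shows "dist x y < (1/3) ^ n"
proof -
  obtain x' y' where x': "x' \<in> carpet" "x = sc_f_word w (sc_f i x')" and y': "y' \<in> carpet" "y = sc_f_word w (sc_f j y')"
    using x unfolding cell_def by (auto simp: sc_f_word_snoc)
  have "sc_f i x' - sc_f j y' = (1/3) *\<^sub>R ((x' - y') + 2 *\<^sub>R (sc_p i - sc_p j))"
    by (simp add: sc_f_def algebra_simps)
  then have "dist (sc_f i x') (sc_f j y') = 1/3 * norm ((x' - y') + 2 *\<^sub>R (sc_p i - sc_p j))"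
    by (simp add: dist_norm)
  also have "\<dots> \<le> 1/3 * (dist x' y' + 2 * dist (sc_p i) (sc_p j))"
    using norm_triangle_ineq[of "x' - y'" "2 *\<^sub>R (sc_p i - sc_p j)"] by (simp add: dist_norm)
  also have "\<dots> < 1" using dist_carpet[OF x'(1) y'(1)] ij(3) by simp
  finally have "(1/3) ^ n * dist (sc_f i x') (sc_f j y') < (1/3) ^ n * 1"
    by (intro mult_strict_left_mono) simp_all
  then show ?thesis unfolding x' y' dist_sc_f_word[OF w] by simp
qed

lemma sum_neighbour_pairs_le:
  fixes g :: "nat \<Rightarrow> nat \<Rightarrow> real"
  assumes "\<And>i j. i < 8 \<Longrightarrow> j < 8 \<Longrightarrow> P i j \<Longrightarrow> g i j \<le> h i j" "\<And>i j. 0 \<le> h i j"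
  shows "(\<Sum>(i, j)\<in>{(i, j). i < 8 \<and> j < 8 \<and> P i j}. g i j) \<le> (\<Sum>i<8. \<Sum>j<8. h i j)"
proof -
  have "(\<Sum>(i, j)\<in>{(i, j). i < 8 \<and> j < 8 \<and> P i j}. g i j) \<le> (\<Sum>(i, j)\<in>{(i, j). i < 8 \<and> j < 8 \<and> P i j}. h i j)"
    using assms(1) by (intro sum_mono) auto
  also have "\<dots> \<le> (\<Sum>(i, j)\<in>{..<8} \<times> {..<8}. h i j)"
    using assms(2) by (intro sum_mono2) auto
  finally show ?thesis by (simp add: sum.cartesian_product)
qed

text \<open>
  Cells whose squares in the grid coincide or touch, possibly only in a corner.
\<close>

definition neighbours :: "nat list \<Rightarrow> nat list \<Rightarrow> bool" where
  "neighbours w w' \<longleftrightarrow> \<bar>int (pos_x w) - int (pos_x w')\<bar> \<le> 1 \<and> \<bar>int (pos_y w) - int (pos_y w')\<bar> \<le> 1"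

lemma neighbours_sym: "neighbours w w' \<longleftrightarrow> neighbours w' w"
  by (auto simp: neighbours_def)

lemma card_neighbours: "card {w' \<in> sc_words n. neighbours w w'} \<le> 9"
proof -
  let ?h = "\<lambda>w'. (int (pos_x w') - int (pos_x w), int (pos_y w') - int (pos_y w))"
  have "inj_on ?h {w' \<in> sc_words n. neighbours w w'}"
  proof (rule inj_onI)
    fix v v' assume "v \<in> {w' \<in> sc_words n. neighbours w w'}" "v' \<in> {w' \<in> sc_words n. neighbours w w'}" "?h v = ?h v'"
    then show "v = v'" using inj_onD[OF inj_on_pos[of n], of v v'] by simp
  qed
  moreover have "?h ` {w' \<in> sc_words n. neighbours w w'} \<subseteq> {-1..1} \<times> {-1..1}"
  proof (rule image_subsetI)
    fix v assume "v \<in> {w' \<in> sc_words n. neighbours w w'}"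
    then show "?h v \<in> {-1..1} \<times> {-1..1}"
      by (simp add: neighbours_def abs_le_iff)
  qed
  ultimately have "card {w' \<in> sc_words n. neighbours w w'} \<le> card ({-1..1::int} \<times> {-1..1::int})"
    by (rule card_inj_on_le) simp
  then show ?thesis by (simp add: card_cartesian_product)
qed

lemma sum_neighbours_le:
  fixes g :: "nat list \<Rightarrow> real"
  assumes g: "\<And>w. w \<in> sc_words n \<Longrightarrow> 0 \<le> g w"
  shows "(\<Sum>w\<in>sc_words n. \<Sum>w'\<in>{w' \<in> sc_words n. neighbours w w'}. g w) \<le> 9 * (\<Sum>w\<in>sc_words n. g w)"
    and "(\<Sum>w\<in>sc_words n. \<Sum>w'\<in>{w' \<in> sc_words n. neighbours w w'}. g w') \<le> 9 * (\<Sum>w\<in>sc_words n. g w)"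
proof -
  have "(\<Sum>w\<in>sc_words n. real (card {w' \<in> sc_words n. neighbours w w'}) * g w) \<le> (\<Sum>w\<in>sc_words n. 9 * g w)"
    using card_neighbours[of n] g by (intro sum_mono mult_right_mono) auto
  then show *: "(\<Sum>w\<in>sc_words n. \<Sum>w'\<in>{w' \<in> sc_words n. neighbours w w'}. g w) \<le> 9 * (\<Sum>w\<in>sc_words n. g w)"
    by (simp add: sum_distrib_left)
  have "(\<Sum>w\<in>sc_words n. \<Sum>w'\<in>{w' \<in> sc_words n. neighbours w w'}. g w')
      = (\<Sum>w'\<in>sc_words n. \<Sum>w\<in>{w \<in> sc_words n. neighbours w w'}. g w')"
    by (rule sum.swap_restrict) simp_all
  also have "\<dots> = (\<Sum>w\<in>sc_words n. \<Sum>w'\<in>{w' \<in> sc_words n. neighbours w w'}. g w)"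
    using neighbours_sym by (simp cong: conj_cong)
  finally show "(\<Sum>w\<in>sc_words n. \<Sum>w'\<in>{w' \<in> sc_words n. neighbours w w'}. g w') \<le> 9 * (\<Sum>w\<in>sc_words n. g w)"
    using * by simp
qed

text \<open>
  Points of \<open>[0, 1] + a\<close> and \<open>[0, 1] + b\<close> with integers \<open>a, b\<close> at distance below 1 force \<open>|a - b| < 2\<close>.
\<close>

lemma close_cells_neighbours:
  assumes w: "w \<in> sc_words n" "w' \<in> sc_words n"
    and x: "x \<in> cell w" "y \<in> cell w'" "dist x y < (1/3) ^ n"
  shows "neighbours w w'"
proof -
  obtain x' y' where x': "x' \<in> carpet" "x = sc_f_word w x'" and y': "y' \<in> carpet" "y = sc_f_word w' y'"
    using x by (auto simp: cell_def)
  let ?d = "(x' + (real (pos_x w), real (pos_y w))) - (y' + (real (pos_x w'), real (pos_y w')))"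
  have "dist x y = (1/3) ^ n * norm ?d"
    unfolding x' y' sc_f_word_affine[OF w(1)] sc_f_word_affine[OF w(2)] dist_norm
    by (simp flip: scaleR_diff_right)
  then have "(1/3) ^ n * norm ?d < (1/3) ^ n * 1" using x(3) by simp
  then have "norm ?d < 1" by (subst (asm) mult_less_cancel_left_pos) simp_all
  then have "\<bar>fst ?d\<bar> < 1" "\<bar>snd ?d\<bar> < 1"
    using norm_fst_le[of "fst ?d" "snd ?d"] norm_snd_le[of "snd ?d" "fst ?d"]
    unfolding prod.collapse real_norm_def by linarith+
  moreover have "fst x' \<in> {0..1}" "snd x' \<in> {0..1}" "fst y' \<in> {0..1}" "snd y' \<in> {0..1}"
    using x'(1) y'(1) carpet_unit by (auto simp: mem_Times_iff)
  ultimately have "\<bar>real (pos_x w) - real (pos_x w')\<bar> < 2" "\<bar>real (pos_y w) - real (pos_y w')\<bar> < 2"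
    by auto
  then show ?thesis unfolding neighbours_def by linarith
qed

text \<open>
  The corners of every square of the construction belong to \<open>V\<^sub>n\<close>, and touching squares have a common corner. This is
  what makes the cells connected through the graph on \<open>V\<^sub>n\<close> without any path argument.
\<close>

lemma neighbours_share_vertex:
  assumes w: "w \<in> sc_words n" "w' \<in> sc_words n" "neighbours w w'"
  obtains i j where "i < 8" "j < 8" "sc_f_word w (sc_p i) = sc_f_word w' (sc_p j)"
proof -
  define a where "a = int (pos_x w') - int (pos_x w)"
  define b where "b = int (pos_y w') - int (pos_y w)"
  have ab: "a \<in> {-1, 0, 1}" "b \<in> {-1, 0, 1}"
    using w(3) by (auto simp: neighbours_def a_def b_def)
  have "\<exists>i<8. \<exists>j<8. sc_p i = sc_p j + (real_of_int a, real_of_int b)"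
  proof -
    have ex: "\<exists>i<8. \<exists>j<8. sc_p i = sc_p j + c"
      if "k < 8" "l < 8" "sc_p k = sc_p l + c" for k l c
      using that by blast
    have "(a, b) \<in> {-1, 0, 1} \<times> {-1, 0, 1}" using ab by blast
    then consider "a = -1" "b = -1" | "a = -1" "b = 0" | "a = -1" "b = 1" | "a = 0" "b = -1"
      | "a = 0" "b = 0" | "a = 0" "b = 1" | "a = 1" "b = -1" | "a = 1" "b = 0" | "a = 1" "b = 1"
      by auto
    then show ?thesis
    proof cases
      case 1 show ?thesis by (rule ex[of 0 4]) (simp_all add: 1 sc_p_def)
    next
      case 2 show ?thesis by (rule ex[of 0 2]) (simp_all add: 2 sc_p_def)
    next
      case 3 show ?thesis by (rule ex[of 6 2]) (simp_all add: 3 sc_p_def)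
    next
      case 4 show ?thesis by (rule ex[of 0 6]) (simp_all add: 4 sc_p_def)
    next
      case 5 show ?thesis by (rule ex[of 0 0]) (simp_all add: 5 sc_p_def)
    next
      case 6 show ?thesis by (rule ex[of 6 0]) (simp_all add: 6 sc_p_def)
    next
      case 7 show ?thesis by (rule ex[of 2 6]) (simp_all add: 7 sc_p_def)
    next
      case 8 show ?thesis by (rule ex[of 2 0]) (simp_all add: 8 sc_p_def)
    next
      case 9 show ?thesis by (rule ex[of 4 0]) (simp_all add: 9 sc_p_def)
    qed
  qed
  then obtain i j where ij: "i < 8" "j < 8" "sc_p i = sc_p j + (real_of_int a, real_of_int b)"
    by blast
  have "sc_f_word w (sc_p i) = sc_f_word w' (sc_p j)"
    unfolding sc_f_word_affine[OF w(1)] sc_f_word_affine[OF w(2)] ij(3)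
    by (cases "sc_p j") (simp add: a_def b_def)
  with ij(1,2) show thesis by (rule that)
qed

lemma neighbours_energy:
  assumes "w \<in> sc_words n" "w' \<in> sc_words n" "neighbours w w'"
  shows "(u (sc_f_word w (sc_p 0)) - u (sc_f_word w' (sc_p 0)))\<^sup>2
    \<le> 196 * (cell_energy w u + cell_energy w' u)"
proof -
  obtain i j where ij: "i < 8" "j < 8" "sc_f_word w (sc_p i) = sc_f_word w' (sc_p j)"
    by (rule neighbours_share_vertex[OF assms])
  let ?a = "u (sc_f_word w (sc_p 0)) - u (sc_f_word w (sc_p i))"
  let ?b = "u (sc_f_word w' (sc_p j)) - u (sc_f_word w' (sc_p 0))"
  have "(u (sc_f_word w (sc_p 0)) - u (sc_f_word w' (sc_p 0)))\<^sup>2 = (?a + ?b)\<^sup>2"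
    using ij(3) by simp
  also have "\<dots> \<le> 2 * ?a\<^sup>2 + 2 * ?b\<^sup>2"
    using sum_squares_bound[of ?a ?b] by (simp add: power2_sum)
  also have "\<dots> \<le> 2 * (98 * cell_energy w u) + 2 * (98 * cell_energy w' u)"
    using cell_energy_vertices[of 0 i u w] cell_energy_vertices[of j 0 u w'] ij by simp
  finally show ?thesis by simp
qed

text \<open>
  The eight subcells form a chain of neighbours, and \<open>f\<^sub>w(p\<^sub>0)\<close> is the corner of the first of them since \<open>p\<^sub>0\<close> is fixed
  by \<open>f\<^sub>0\<close>. The constant is \<open>49 \<cdot> 2 \<cdot> 196\<close>.
\<close>

lemma child_corner_energy:
  assumes w: "w \<in> sc_words n" and i: "i < 8"
  shows "(u (sc_f_word (w @ [i]) (sc_p 0)) - u (sc_f_word w (sc_p 0)))\<^sup>2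
    \<le> 19208 * (\<Sum>j<8. cell_energy (w @ [j]) u)"
proof -
  let ?e = "\<Sum>j<8. cell_energy (w @ [j]) u"
  have le: "cell_energy (w @ [k]) u \<le> ?e" if "k < 8" for k
    by (rule member_le_sum) (use that cell_energy_nonneg in auto)
  have "(u (sc_f_word (w @ [k]) (sc_p 0)) - u (sc_f_word (w @ [Suc k]) (sc_p 0)))\<^sup>2 \<le> 392 * ?e"
    if "Suc k < 8" for k
  proof -
    have "neighbours (w @ [k]) (w @ [Suc k])"
      using digit_Suc[OF that] by (simp add: neighbours_def)
    from neighbours_energy[OF sc_words_snocI sc_words_snocI this] w that
    have "(u (sc_f_word (w @ [k]) (sc_p 0)) - u (sc_f_word (w @ [Suc k]) (sc_p 0)))\<^sup>2
      \<le> 196 * (cell_energy (w @ [k]) u + cell_energy (w @ [Suc k]) u)" by simp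
    also have "\<dots> \<le> 196 * (?e + ?e)"
      using le that by (intro mult_left_mono add_mono) auto
    finally show ?thesis by simp
  qed
  from square_telescope_le[where g = "\<lambda>k. u (sc_f_word (w @ [k]) (sc_p 0))" and j = 0, OF this i]
  have "(u (sc_f_word (w @ [i]) (sc_p 0)) - u (sc_f_word (w @ [0]) (sc_p 0)))\<^sup>2 \<le> 49 * (392 * ?e)"
    by simp
  then show ?thesis by (simp add: sc_f_word_snoc sc_f_fixed)
qed

section \<open>Hausdorff measure of the cells\<close>

text \<open>
  A cover of \<open>A\<close> is transported to a cover of the image by \<open>U \<mapsto> f(U \<inter> A)\<close>; the intersection is needed because \<open>f\<close> is a
  similarity on \<open>A\<close> only.
\<close>

lemma hausdorff_content_similarity:
  fixes f :: "'a::metric_space \<Rightarrow> 'b::metric_space"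
  assumes r: "r > 0" and s: "s \<ge> 0"
    and f: "\<And>x y. x \<in> A \<Longrightarrow> y \<in> A \<Longrightarrow> dist (f x) (f y) = r * dist x y"
  shows "hausdorff_content s (r * \<delta>) (f ` A) \<le> ennreal (r powr s) * hausdorff_content s \<delta> A"
proof -
  let ?X = "hausdorff_content s (r * \<delta>) (f ` A)"
  have le: "?X \<le> ennreal (r powr s) * (\<Sum>i. ennreal (diameter (U i) powr s))"
    if U: "\<And>i. bounded (U i)" "\<And>i. diameter (U i) \<le> \<delta>" "A \<subseteq> (\<Union>i. U i)" for U :: "nat \<Rightarrow> 'a set"
  proof -
    define V where "V i = f ` (U i \<inter> A)" for i
    have dist: "dist x y \<le> r * diameter (U i)" if xy: "x \<in> V i" "y \<in> V i" for x y i
    proof -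
      obtain x' y' where *: "x' \<in> U i" "x' \<in> A" "x = f x'" "y' \<in> U i" "y' \<in> A" "y = f y'"
        using xy unfolding V_def by blast
      have "dist x y = r * dist x' y'" using f * by simp
      also have "\<dots> \<le> r * diameter (U i)"
        using diameter_bounded_bound[OF U(1) *(1,4)] r by (intro mult_left_mono) auto
      finally show ?thesis .
    qed
    have bdd: "bounded (V i)" for i
      using dist unfolding bounded_two_points by blast
    have diam: "diameter (V i) \<le> r * diameter (U i)" for i
    proof (cases "V i = {}")
      case True
      then show ?thesis using r diameter_ge_0[OF U(1)] by simp
    next
      case False
      have "(SUP (x, y)\<in>V i \<times> V i. dist x y) \<le> r * diameter (U i)"
        by (rule cSUP_least) (use False dist in auto)
      then show ?thesis using False by (simp add: diameter_def)
    qed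
    have "f ` A \<subseteq> (\<Union>i. V i)" using U(3) unfolding V_def by blast
    moreover have "diameter (V i) \<le> r * \<delta>" for i
      by (rule order_trans[OF diam]) (use U(2) r in simp)
    ultimately have "?X \<le> (\<Sum>i. ennreal (diameter (V i) powr s))"
      unfolding hausdorff_content_def by (intro INF_lower) (use bdd in auto)
    also have "\<dots> \<le> (\<Sum>i. ennreal (r powr s) * ennreal (diameter (U i) powr s))"
    proof (intro suminf_le summableI)
      fix i
      have "diameter (V i) powr s \<le> (r * diameter (U i)) powr s"
        using diam s by (intro powr_mono2 diameter_ge_0 bdd) auto
      also have "\<dots> = r powr s * diameter (U i) powr s"
        using r diameter_ge_0[OF U(1)] by (simp add: powr_mult)
      finally show "ennreal (diameter (V i) powr s) \<le> ennreal (r powr s) * ennreal (diameter (U i) powr s)"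
        by (simp add: ennreal_leI flip: ennreal_mult)
    qed
    finally show ?thesis by simp
  qed
  have c: "ennreal (r powr s) * ennreal (1 / r powr s) = 1"
    using r by (simp flip: ennreal_mult)
  have "ennreal (1 / r powr s) * ?X \<le> hausdorff_content s \<delta> A"
    unfolding hausdorff_content_def[of s \<delta> A]
  proof (rule INF_greatest)
    fix U :: "nat \<Rightarrow> 'a set" 
    assume "U \<in> {U. (\<forall>i. bounded (U i) \<and> diameter (U i) \<le> \<delta>) \<and> A \<subseteq> (\<Union>i. U i)}"
    then have "ennreal (1 / r powr s) * ?X \<le> ennreal (1 / r powr s) * (ennreal (r powr s) * (\<Sum>i. ennreal (diameter (U i) powr s)))"
      by (intro mult_left_mono le) auto
    also have "\<dots> = (\<Sum>i. ennreal (diameter (U i) powr s))"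
      using c by (simp add: mult.commute mult.left_commute flip: mult.assoc)
    finally show "ennreal (1 / r powr s) * ?X \<le> (\<Sum>i. ennreal (diameter (U i) powr s))" .
  qed
  then have "ennreal (r powr s) * (ennreal (1 / r powr s) * ?X) \<le> ennreal (r powr s) * hausdorff_content s \<delta> A"
    by (rule mult_left_mono) simp
  then show ?thesis using c by (simp flip: mult.assoc)
qed

text \<open>
  One inequality is the transport of covers, the other one is the same for the inverse map.
\<close>

lemma hausdorff_outer_similarity:
  fixes f :: "'a::metric_space \<Rightarrow> 'b::metric_space"
  assumes r: "r > 0" and s: "s \<ge> 0"
    and f: "\<And>x y. x \<in> A \<Longrightarrow> y \<in> A \<Longrightarrow> dist (f x) (f y) = r * dist x y"
  shows "hausdorff_outer s (f ` A) = ennreal (r powr s) * hausdorff_outer s A"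
proof -
  have le: "hausdorff_outer s (g ` B) \<le> ennreal (q powr s) * hausdorff_outer s B"
    if q: "q > 0" and g: "\<And>x y. x \<in> B \<Longrightarrow> y \<in> B \<Longrightarrow> dist (g x) (g y) = q * dist x y"
    for g :: "'c::metric_space \<Rightarrow> 'd::metric_space" and q B
    unfolding hausdorff_outer_def[of s "g ` B"]
  proof (rule SUP_least)
    fix \<delta> :: real assume \<delta>: "\<delta> \<in> {0<..}"
    have "hausdorff_content s (q * (\<delta> / q)) (g ` B) \<le> ennreal (q powr s) * hausdorff_content s (\<delta> / q) B"
      by (rule hausdorff_content_similarity[OF q s g])
    also have "\<dots> \<le> ennreal (q powr s) * hausdorff_outer s B"
      unfolding hausdorff_outer_def by (intro mult_left_mono SUP_upper) (use \<delta> q in auto)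
    finally show "hausdorff_content s \<delta> (g ` B) \<le> ennreal (q powr s) * hausdorff_outer s B"
      using q by simp
  qed
  have inj: "inj_on f A"
  proof (rule inj_onI)
    fix x y assume "x \<in> A" "y \<in> A" "f x = f y"
    then show "x = y" using f[of x y] r by simp
  qed
  define g where "g = inv_into A f"
  have "g ` f ` A = A" using inj by (simp add: g_def)
  moreover have "dist (g x) (g y) = (1 / r) * dist x y" if "x \<in> f ` A" "y \<in> f ` A" for x y
    using f[of "g x" "g y"] that r by (simp add: g_def inv_into_into f_inv_into_f)
  ultimately have "hausdorff_outer s A \<le> ennreal ((1 / r) powr s) * hausdorff_outer s (f ` A)"
    using le[of "1 / r" "f ` A" g] r by simp
  then have "ennreal (r powr s) * hausdorff_outer s A
      \<le> ennreal (r powr s) * (ennreal ((1 / r) powr s) * hausdorff_outer s (f ` A))"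
    by (rule mult_left_mono) simp
  also have "\<dots> = hausdorff_outer s (f ` A)"
  proof -
    have "ennreal (r powr s) * ennreal ((1 / r) powr s) = 1"
      using r by (simp add: powr_divide flip: ennreal_mult)
    then show ?thesis by (simp flip: mult.assoc)
  qed
  finally show ?thesis using le[OF r f] by (intro antisym)
qed

lemma third_powr_alpha: "((1/3) ^ n) powr sc_alpha = (1/8) ^ n"
proof -
  have "(1/3) powr sc_alpha = 1/8"
    by (simp add: powr_def sc_alpha_def ln_div exp_minus)
  then have "((1/3) ^ Suc n) powr sc_alpha = 1/8 * ((1/3) ^ n) powr sc_alpha" for n
    using powr_mult[of "1/3" "(1/3) ^ n" sc_alpha] by simp
  then show ?thesis by (induction n) (simp_all only: power_Suc, simp)
qed

lemma sc_alpha_nonneg: "0 \<le> sc_alpha"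
  by (simp add: sc_alpha_def)

lemma hausdorff_outer_cell:
  assumes "w \<in> sc_words n"
  shows "hausdorff_outer sc_alpha (cell w) = ennreal ((1/8) ^ n) * hausdorff_outer sc_alpha carpet"
  unfolding cell_def
  by (subst hausdorff_outer_similarity[where r = "(1/3) ^ n"])
    (simp_all add: dist_sc_f_word[OF assms] third_powr_alpha sc_alpha_nonneg)

lemma sets_hausdorff_measure [simp, measurable_cong]: "sets (hausdorff_measure s) = sets borel"
  and space_hausdorff_measure [simp]: "space (hausdorff_measure s) = UNIV"
  unfolding hausdorff_measure_def
  using sigma_algebra.sets_measure_of_eq[of UNIV "sets borel"] sigma_algebra.space_measure_of_eq[of UNIV "sets borel"]
    sets.sigma_algebra_axioms[of borel] by (simp_all)

text \<open>
  A measure built from a set function is the null measure unless the set function is countably additive on the generated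
  \<open>\<sigma>\<close>-algebra. A single set of nonzero measure thus certifies that the measure is the outer measure on all Borel sets.
\<close>

lemma hausdorff_measure_eq_outer:
  fixes A B :: "'a::metric_space set"
  assumes "emeasure (hausdorff_measure s) B \<noteq> 0" "A \<in> sets borel"
  shows "emeasure (hausdorff_measure s) A = hausdorff_outer s A"
proof -
  have "sigma_sets UNIV (sets borel) = sets (borel :: 'a measure)"
    using sets.sigma_sets_eq[of borel] by simp
  then show ?thesis
    using assms by (auto simp: hausdorff_measure_def emeasure_measure_of_conv split: if_splits)
qed

lemma carpet_borel [measurable]: "carpet \<in> sets borel"
  using compact_carpet by (simp add: compact_imp_closed)

lemma space_sc_nu [simp]: "space sc_nu = carpet"
  by (simp add: sc_nu_def space_restrict_space)

lemma sets_sc_nu [measurable_cong]: "sets sc_nu = sets (restrict_space borel carpet)"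
  by (simp add: sc_nu_def sets_restrict_space)

lemma emeasure_sc_nu:
  assumes "A \<in> sets borel" "A \<subseteq> carpet"
  shows "emeasure sc_nu A = emeasure (hausdorff_measure sc_alpha) A / emeasure (hausdorff_measure sc_alpha) carpet"
  using assms by (simp add: sc_nu_def emeasure_restrict_space Int_absorb1)

lemma borel_measurable_sc_nu_continuous:
  "continuous_on carpet v \<Longrightarrow> v \<in> borel_measurable sc_nu"
  by (subst measurable_cong_sets[OF sets_sc_nu refl]) (rule borel_measurable_continuous_on_restrict)

lemma cell_sets [measurable]: "w \<in> sc_words n \<Longrightarrow> cell w \<in> sets sc_nu"
  using compact_cell[of w n] cell_subset[of w n]
  by (auto simp: sets_sc_nu sets_restrict_space_iff compact_imp_closed)

text \<open>
  The situation in which \<open>\<nu>\<close> is a probability measure on the carpet; otherwise it is the null measure.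
\<close>

locale carpet_mass =
  assumes carpet_mass_pos: "emeasure (hausdorff_measure sc_alpha) carpet \<noteq> 0"
    and carpet_mass_finite: "emeasure (hausdorff_measure sc_alpha) carpet \<noteq> \<infinity>"
begin

lemma emeasure_cell:
  assumes "w \<in> sc_words n"
  shows "emeasure sc_nu (cell w) = ennreal ((1/8) ^ n)"
proof -
  have "emeasure (hausdorff_measure sc_alpha) (cell w) = ennreal ((1/8) ^ n) * emeasure (hausdorff_measure sc_alpha) carpet"
    using hausdorff_outer_cell[OF assms] compact_cell[OF assms] carpet_mass_pos
    by (simp add: hausdorff_measure_eq_outer[OF carpet_mass_pos] compact_imp_closed)
  then show ?thesis
    using emeasure_sc_nu[of "cell w"] compact_cell[OF assms] cell_subset[OF assms]
      carpet_mass_pos carpet_mass_finite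
    by (simp add: compact_imp_closed ennreal_mult_divide_eq)
qed

lemma emeasure_carpet: "emeasure sc_nu carpet = 1"
  using emeasure_cell[of "[]" 0] by simp

sublocale finite_measure sc_nu
  by standard (simp add: emeasure_carpet)

text \<open>
  Cells of the same level overlap in null sets only, by counting mass: the cells cover the carpet, so the sum of the
  indicators is at least 1, while its integral is \<open>8\<^sup>n \<cdot> 8\<^sup>-\<^sup>n = 1\<close>.
\<close>

lemma AE_sum_cells: "AE x in sc_nu. (\<Sum>w\<in>sc_words n. indicator (cell w) x) = (1::ennreal)"
proof -
  let ?f = "\<lambda>x. \<Sum>w\<in>sc_words n. indicator (cell w) x :: ennreal"
  have [measurable]: "?f \<in> borel_measurable sc_nu"
    by (intro borel_measurable_sum borel_measurable_indicator cell_sets)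
  have ge: "1 \<le> ?f x" if x: "x \<in> carpet" for x
  proof -
    obtain w where w: "w \<in> sc_words n" "x \<in> cell w"
      using x carpet_eq_cells[of n] by blast
    then have "1 = (indicator (cell w) x :: ennreal)" by simp
    also have "\<dots> \<le> ?f x" using w by (intro member_le_sum) auto
    finally show ?thesis .
  qed
  have "(\<integral>\<^sup>+x. ?f x \<partial>sc_nu) = (\<Sum>w\<in>sc_words n. emeasure sc_nu (cell w))"
    by (subst nn_integral_sum) (auto intro!: sum.cong borel_measurable_indicator cell_sets nn_integral_indicator)
  also have "\<dots> = (\<Sum>w\<in>sc_words n. ennreal ((1/8) ^ n))"
    using emeasure_cell by (intro sum.cong) auto
  also have "\<dots> = 1"
    by (subst sum_ennreal) (simp_all add: card_sc_words power_divide)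
  finally have int: "(\<integral>\<^sup>+x. ?f x \<partial>sc_nu) = 1" .
  have "(\<integral>\<^sup>+x. ?f x - 1 \<partial>sc_nu) = (\<integral>\<^sup>+x. ?f x \<partial>sc_nu) - (\<integral>\<^sup>+x. 1 \<partial>sc_nu)"
    by (rule nn_integral_diff) (use ge in \<open>auto simp: emeasure_carpet\<close>)
  also have "\<dots> = 0" using int by (simp add: emeasure_carpet)
  finally have "AE x in sc_nu. ?f x - 1 = 0"
    by (subst (asm) nn_integral_0_iff_AE) auto
  then show ?thesis
    using AE_space
  proof eventually_elim
    case (elim x)
    then show ?case using ge[of x] by (intro antisym) (auto simp: diff_eq_0_iff_ennreal)
  qed
qed

lemma nn_integral_cells:
  assumes [measurable]: "g \<in> borel_measurable sc_nu"
  shows "(\<Sum>w\<in>sc_words n. \<integral>\<^sup>+x. g x * indicator (cell w) x \<partial>sc_nu) = (\<integral>\<^sup>+x. g x \<partial>sc_nu)"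
proof -
  have "(\<Sum>w\<in>sc_words n. \<integral>\<^sup>+x. g x * indicator (cell w) x \<partial>sc_nu)
      = (\<integral>\<^sup>+x. (\<Sum>w\<in>sc_words n. g x * indicator (cell w) x) \<partial>sc_nu)"
    by (rule nn_integral_sum[symmetric]) (intro borel_measurable_times_ennreal assms borel_measurable_indicator cell_sets)
  also have "\<dots> = (\<integral>\<^sup>+x. g x \<partial>sc_nu)"
    using AE_sum_cells[of n] by (intro nn_integral_cong_AE) (auto simp flip: sum_distrib_left)
  finally show ?thesis .
qed

end

section \<open>The near-diagonal energy\<close>

definition near_energy :: "nat \<Rightarrow> (point \<Rightarrow> real) \<Rightarrow> point \<Rightarrow> ennreal" where
  "near_energy n u x = (\<integral>\<^sup>+y. ennreal ((u x - u y)\<^sup>2) * indicator (ball x ((1/3) ^ n)) y \<partial>sc_nu)"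

lemma ball_pairs_measurable [measurable]:
  "(\<lambda>(x, y). indicator (ball x r) y :: ennreal) \<in> borel_measurable (sc_nu \<Otimes>\<^sub>M sc_nu)"
proof -
  have "(\<lambda>z. dist (fst z) (snd z)) \<in> borel_measurable (sc_nu \<Otimes>\<^sub>M sc_nu)"
  proof (rule borel_measurable_dist)
    have id: "(\<lambda>x. x) \<in> measurable sc_nu borel"
      by (simp add: measurable_cong_sets[OF sets_sc_nu refl] measurable_restrict_space1)
    show "fst \<in> measurable (sc_nu \<Otimes>\<^sub>M sc_nu) borel" "snd \<in> measurable (sc_nu \<Otimes>\<^sub>M sc_nu) borel"
      by (rule measurable_compose[OF measurable_fst id], rule measurable_compose[OF measurable_snd id])
  qed
  then have [measurable]: "(\<lambda>(x, y). dist x y) \<in> borel_measurable (sc_nu \<Otimes>\<^sub>M sc_nu)"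
    by (simp add: case_prod_unfold)
  have "(\<lambda>(x :: point, y). indicator (ball x r) y :: ennreal) = (\<lambda>z. if (case z of (x, y) \<Rightarrow> dist x y) < r then 1 else 0)"
    by (intro ext) (auto simp: indicator_def)
  then show ?thesis by simp
qed

context carpet_mass
begin

lemma near_energy_measurable [measurable]:
  assumes [measurable]: "u \<in> borel_measurable sc_nu"
  shows "near_energy n u \<in> borel_measurable sc_nu"
  unfolding near_energy_def
proof (rule borel_measurable_nn_integral)
  have "(\<lambda>z. ennreal ((u (fst z) - u (snd z))\<^sup>2) * (case z of (x, y) \<Rightarrow> indicator (ball x ((1/3) ^ n)) y))
      \<in> borel_measurable (sc_nu \<Otimes>\<^sub>M sc_nu)"
    by (rule borel_measurable_times_ennreal[OF _ ball_pairs_measurable]) measurable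
  then show "(\<lambda>(x, y). ennreal ((u x - u y)\<^sup>2) * indicator (ball x ((1/3) ^ n)) y)
      \<in> borel_measurable (sc_nu \<Otimes>\<^sub>M sc_nu)" by (simp add: case_prod_unfold)
qed

end

lemma powr_beta_star:
  assumes "\<rho> > 0"
  shows "3 powr ((sc_alpha + beta_star \<rho>) * real n) = (64 * \<rho>) ^ n"
    and "3 powr ((beta_star \<rho> - sc_alpha) * real n) = \<rho> ^ n"
proof -
  have "3 powr (sc_alpha + beta_star \<rho>) = 64 * \<rho>"
    using assms by (simp add: powr_def sc_alpha_def beta_star_def ring_distribs exp_add)
  then show "3 powr ((sc_alpha + beta_star \<rho>) * real n) = (64 * \<rho>) ^ n"
    using assms by (simp add: powr_realpow flip: powr_powr)
  have "3 powr (beta_star \<rho> - sc_alpha) = \<rho>"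
    using assms by (simp add: powr_def sc_alpha_def beta_star_def ring_distribs exp_diff left_diff_distrib)
  then show "3 powr ((beta_star \<rho> - sc_alpha) * real n) = \<rho> ^ n"
    using assms by (simp add: powr_realpow flip: powr_powr)
qed

lemma besov_seminorm_eq:
  assumes "\<rho> > 0"
  shows "besov_seminorm (beta_star \<rho>) u = (SUP n\<in>{1..}. ennreal ((64 * \<rho>) ^ n) * (\<integral>\<^sup>+x. near_energy n u x \<partial>sc_nu))"
  unfolding besov_seminorm_def near_energy_def powr_beta_star[OF assms] ..

lemma sup_energy_eq:
  assumes "\<rho> > 0"
  shows "sup_energy (beta_star \<rho>) u = (SUP n\<in>{1..}. ennreal (\<rho> ^ n * sc_D n u))"
  unfolding sup_energy_def powr_beta_star[OF assms] ..

section \<open>From discrete energies to the Besov seminorm\<close>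

lemma continuous_carpet_bounded:
  assumes "continuous_on carpet v"
  obtains e :: real where "\<And>x y. x \<in> carpet \<Longrightarrow> y \<in> carpet \<Longrightarrow> \<bar>v x - v y\<bar> \<le> e"
proof -
  have "bounded (v ` carpet)"
    by (intro compact_imp_bounded compact_continuous_image assms compact_carpet)
  then obtain e where "\<forall>x\<in>v ` carpet. \<forall>y\<in>v ` carpet. dist x y \<le> e"
    unfolding bounded_two_points by blast
  then show thesis by (intro that[of e]) (simp add: dist_real_def)
qed

lemma continuous_carpet_cells:
  assumes v: "continuous_on carpet v" and e: "(e :: real) > 0"
  shows "\<exists>N. \<forall>n\<ge>N. \<forall>w\<in>sc_words n. \<forall>x\<in>cell w. \<forall>y\<in>cell w. \<bar>v x - v y\<bar> < e"
proof -
  have "uniformly_continuous_on carpet v"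
    by (rule compact_uniformly_continuous[OF v compact_carpet])
  then obtain d where d: "d > 0" "\<And>x y. x \<in> carpet \<Longrightarrow> y \<in> carpet \<Longrightarrow> dist y x < d \<Longrightarrow> dist (v y) (v x) < e"
    using e unfolding uniformly_continuous_on_def by metis
  have "(\<lambda>n. 3/2 * (1/3) ^ n) \<longlonglongrightarrow> 3/2 * (0::real)"
    by (intro tendsto_intros LIMSEQ_realpow_zero) auto
  then have "\<forall>\<^sub>F n in sequentially. 3/2 * (1/3) ^ n < d"
    by (rule order_tendstoD(2)) (simp add: d(1))
  then obtain N where N: "\<And>n. n \<ge> N \<Longrightarrow> 3/2 * (1/3) ^ n < d"
    unfolding eventually_sequentially by blast
  have "\<bar>v x - v y\<bar> < e" if "n \<ge> N" "w \<in> sc_words n" "x \<in> cell w" "y \<in> cell w" for n w x y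
  proof -
    have "dist x y < d" using dist_cell[OF that(2-4)] N[OF that(1)] by simp
    moreover have "x \<in> carpet" "y \<in> carpet" using cell_subset[OF that(2)] that(3,4) by auto
    ultimately show ?thesis using d(2)[of y x] by (simp add: dist_real_def)
  qed
  then show ?thesis by blast
qed

definition corner :: "nat list \<Rightarrow> point" where
  "corner w = sc_f_word w (sc_p 0)"

lemma corner_in_cell: "corner w \<in> cell w"
  by (simp add: corner_def sc_f_word_in_cell sc_p_carpet)

definition corner_dev :: "(point \<Rightarrow> real) \<Rightarrow> nat list \<Rightarrow> real" where
  "corner_dev v w = enn2real (\<integral>\<^sup>+x. ennreal ((v x - v (corner w))\<^sup>2) * indicator (cell w) x \<partial>sc_nu)"

lemma corner_dev_nonneg: "0 \<le> corner_dev v w"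
  by (simp add: corner_dev_def)

context carpet_mass
begin

lemma corner_dev_le:
  assumes w: "w \<in> sc_words n" and e: "\<And>x y. x \<in> cell w \<Longrightarrow> y \<in> cell w \<Longrightarrow> \<bar>v x - v y\<bar> \<le> e"
  shows "(\<integral>\<^sup>+x. ennreal ((v x - v (corner w))\<^sup>2) * indicator (cell w) x \<partial>sc_nu) \<le> ennreal (e\<^sup>2 * (1/8) ^ n)"
proof -
  have "(\<integral>\<^sup>+x. ennreal ((v x - v (corner w))\<^sup>2) * indicator (cell w) x \<partial>sc_nu)
      \<le> (\<integral>\<^sup>+x. ennreal (e\<^sup>2) * indicator (cell w) x \<partial>sc_nu)"
  proof (intro nn_integral_mono)
    fix x
    show "ennreal ((v x - v (corner w))\<^sup>2) * indicator (cell w) x \<le> ennreal (e\<^sup>2) * indicator (cell w) x"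
    proof (cases "x \<in> cell w")
      case True
      then have "(v x - v (corner w))\<^sup>2 \<le> e\<^sup>2"
        using e[OF True corner_in_cell] by (intro abs_le_square_iff[THEN iffD1]) simp
      then show ?thesis using True by (simp add: ennreal_leI)
    qed simp
  qed
  also have "\<dots> = ennreal (e\<^sup>2) * ennreal ((1/8) ^ n)"
    using w by (simp add: nn_integral_cmult_indicator cell_sets emeasure_cell)
  finally show ?thesis by (simp add: ennreal_mult)
qed

lemma ennreal_corner_dev:
  assumes v: "continuous_on carpet v" and w: "w \<in> sc_words n"
  shows "ennreal (corner_dev v w) = (\<integral>\<^sup>+x. ennreal ((v x - v (corner w))\<^sup>2) * indicator (cell w) x \<partial>sc_nu)"
proof -
  obtain e where e: "\<And>x y. x \<in> carpet \<Longrightarrow> y \<in> carpet \<Longrightarrow> \<bar>v x - v y\<bar> \<le> e"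
    using continuous_carpet_bounded[OF v] by blast
  have "(\<integral>\<^sup>+x. ennreal ((v x - v (corner w))\<^sup>2) * indicator (cell w) x \<partial>sc_nu) \<le> ennreal (e\<^sup>2 * (1/8) ^ n)"
    using e cell_subset[OF w] by (intro corner_dev_le[OF w]) blast
  also have "\<dots> < \<infinity>" by simp
  finally have "(\<integral>\<^sup>+x. ennreal ((v x - v (corner w))\<^sup>2) * indicator (cell w) x \<partial>sc_nu) < \<infinity>" .
  then show ?thesis unfolding corner_dev_def by (simp add: less_top)
qed

lemma sum_corner_dev_tendsto_0:
  assumes v: "continuous_on carpet v"
  shows "(\<lambda>n. \<Sum>w\<in>sc_words n. corner_dev v w) \<longlonglongrightarrow> 0"
proof (rule LIMSEQ_I)
  fix r :: real assume r: "r > 0"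
  define e where "e = sqrt (r / 2)"
  obtain N where N: "\<And>n w x y. n \<ge> N \<Longrightarrow> w \<in> sc_words n \<Longrightarrow> x \<in> cell w \<Longrightarrow> y \<in> cell w \<Longrightarrow> \<bar>v x - v y\<bar> < e"
    using continuous_carpet_cells[OF v, of e] r unfolding e_def by (metis half_gt_zero real_sqrt_gt_zero)
  have "norm ((\<Sum>w\<in>sc_words n. corner_dev v w) - 0) < r" if n: "n \<ge> N" for n
  proof -
    have "corner_dev v w \<le> e\<^sup>2 * (1/8) ^ n" if w: "w \<in> sc_words n" for w
    proof -
      have "ennreal (corner_dev v w) \<le> ennreal (e\<^sup>2 * (1/8) ^ n)"
        unfolding ennreal_corner_dev[OF v w]
        by (rule corner_dev_le[OF w]) (use N[OF n w] in \<open>simp add: less_imp_le\<close>)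
      then show ?thesis by (simp add: ennreal_le_iff)
    qed
    then have "(\<Sum>w\<in>sc_words n. corner_dev v w) \<le> (\<Sum>w\<in>sc_words n. e\<^sup>2 * (1/8) ^ n)"
      by (rule sum_mono)
    also have "\<dots> = r / 2" using r by (simp add: card_sc_words e_def power_divide)
    finally show ?thesis using r by (simp add: sum_nonneg corner_dev_nonneg)
  qed
  then show "\<exists>N. \<forall>n\<ge>N. norm ((\<Sum>w\<in>sc_words n. corner_dev v w) - 0) < r" by blast
qed

text \<open>
  Pass from \<open>f\<^sub>w(p\<^sub>0)\<close> to the corner of the subcell containing \<open>x\<close>, at the cost of one squared difference of level \<open>n + 1\<close>
  times the mass of the subcells.
\<close>

lemma corner_dev_step:
  assumes v: "continuous_on carpet v" and w: "w \<in> sc_words n" and t: "t > 0"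
  shows "corner_dev v w \<le> (1 + t) * (\<Sum>i<8. corner_dev v (w @ [i]))
     + (1 + 1 / t) * (19208 * (1/8) ^ n * (\<Sum>i<8. cell_energy (w @ [i]) v))"
proof -
  let ?e = "\<Sum>i<8. cell_energy (w @ [i]) v"
  have [measurable]: "v \<in> borel_measurable sc_nu"
    by (rule borel_measurable_sc_nu_continuous[OF v])
  have e0: "0 \<le> ?e" by (intro sum_nonneg cell_energy_nonneg)
  have sets [measurable]: "cell (w @ [i]) \<in> sets sc_nu" if "i < 8" for i
    by (rule cell_sets[OF sc_words_snocI[OF w that]])
  have pw: "ennreal ((v x - v (corner w))\<^sup>2) * indicator (cell w) x
     \<le> (\<Sum>i<8. (ennreal (1 + t) * ennreal ((v x - v (corner (w @ [i])))\<^sup>2)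
          + ennreal ((1 + 1 / t) * (19208 * ?e))) * indicator (cell (w @ [i])) x)" for x
  proof (cases "x \<in> cell w")
    case True
    then obtain i where i: "i < 8" "x \<in> cell (w @ [i])" using cell_split by blast
    have "(v x - v (corner w))\<^sup>2 = ((v x - v (corner (w @ [i]))) + (v (corner (w @ [i])) - v (corner w)))\<^sup>2"
      by simp
    also have "\<dots> \<le> (1 + t) * (v x - v (corner (w @ [i])))\<^sup>2 + (1 + 1 / t) * (v (corner (w @ [i])) - v (corner w))\<^sup>2"
      by (rule weighted_square_sum[OF t])
    also have "\<dots> \<le> (1 + t) * (v x - v (corner (w @ [i])))\<^sup>2 + (1 + 1 / t) * (19208 * ?e)"
      using child_corner_energy[OF w i(1), of v] t unfolding corner_def
      by (intro add_left_mono mult_left_mono) auto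
    finally have "ennreal ((v x - v (corner w))\<^sup>2)
        \<le> ennreal ((1 + t) * (v x - v (corner (w @ [i])))\<^sup>2 + (1 + 1 / t) * (19208 * ?e))"
      by (rule ennreal_leI)
    also have "\<dots> = ennreal ((1 + t) * (v x - v (corner (w @ [i])))\<^sup>2) + ennreal ((1 + 1 / t) * (19208 * ?e))"
      using t e0 by (intro ennreal_plus) simp_all
    also have "ennreal ((1 + t) * (v x - v (corner (w @ [i])))\<^sup>2) = ennreal (1 + t) * ennreal ((v x - v (corner (w @ [i])))\<^sup>2)"
      using t by (intro ennreal_mult) simp_all
    finally have "ennreal ((v x - v (corner w))\<^sup>2) \<le> ennreal (1 + t) * ennreal ((v x - v (corner (w @ [i])))\<^sup>2)
        + ennreal ((1 + 1 / t) * (19208 * ?e))" .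
    then have "ennreal ((v x - v (corner w))\<^sup>2) * indicator (cell w) x
      \<le> (ennreal (1 + t) * ennreal ((v x - v (corner (w @ [i])))\<^sup>2)
        + ennreal ((1 + 1 / t) * (19208 * ?e))) * indicator (cell (w @ [i])) x"
      using True i(2) by simp
    also have "\<dots> \<le> (\<Sum>i<8. (ennreal (1 + t) * ennreal ((v x - v (corner (w @ [i])))\<^sup>2)
          + ennreal ((1 + 1 / t) * (19208 * ?e))) * indicator (cell (w @ [i])) x)"
      by (rule member_le_sum) (use i in auto)
    finally show ?thesis .
  qed simp
  have "ennreal (corner_dev v w)
      \<le> (\<integral>\<^sup>+x. (\<Sum>i<8. (ennreal (1 + t) * ennreal ((v x - v (corner (w @ [i])))\<^sup>2)
          + ennreal ((1 + 1 / t) * (19208 * ?e))) * indicator (cell (w @ [i])) x) \<partial>sc_nu)"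
    unfolding ennreal_corner_dev[OF v w] by (intro nn_integral_mono pw)
  also have "\<dots> = (\<Sum>i<8. \<integral>\<^sup>+x. (ennreal (1 + t) * ennreal ((v x - v (corner (w @ [i])))\<^sup>2)
          + ennreal ((1 + 1 / t) * (19208 * ?e))) * indicator (cell (w @ [i])) x \<partial>sc_nu)"
    by (rule nn_integral_sum) (use sets in measurable)
  also have "\<dots> = (\<Sum>i<8. ennreal ((1 + t) * corner_dev v (w @ [i]) + (1 + 1 / t) * (19208 * ?e) * (1/8) ^ Suc n))"
  proof (rule sum.cong[OF refl])
    fix i :: nat assume "i \<in> {..<8}"
    then have i: "i < 8" by simp
    note [measurable] = sets[OF i]
    have "(\<integral>\<^sup>+x. (ennreal (1 + t) * ennreal ((v x - v (corner (w @ [i])))\<^sup>2)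
          + ennreal ((1 + 1 / t) * (19208 * ?e))) * indicator (cell (w @ [i])) x \<partial>sc_nu)
       = (\<integral>\<^sup>+x. ennreal (1 + t) * (ennreal ((v x - v (corner (w @ [i])))\<^sup>2) * indicator (cell (w @ [i])) x)
          + ennreal ((1 + 1 / t) * (19208 * ?e)) * indicator (cell (w @ [i])) x \<partial>sc_nu)"
      by (simp add: distrib_right mult.assoc)
    also have "\<dots> = ennreal (1 + t) * ennreal (corner_dev v (w @ [i]))
          + ennreal ((1 + 1 / t) * (19208 * ?e)) * ennreal ((1/8) ^ Suc n)"
      unfolding ennreal_corner_dev[OF v sc_words_snocI[OF w i]] emeasure_cell[OF sc_words_snocI[OF w i], symmetric]
      by (subst nn_integral_add) (simp_all add: nn_integral_cmult nn_integral_cmult_indicator)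
    finally show "(\<integral>\<^sup>+x. (ennreal (1 + t) * ennreal ((v x - v (corner (w @ [i])))\<^sup>2)
          + ennreal ((1 + 1 / t) * (19208 * ?e))) * indicator (cell (w @ [i])) x \<partial>sc_nu)
       = ennreal ((1 + t) * corner_dev v (w @ [i]) + (1 + 1 / t) * (19208 * ?e) * (1/8) ^ Suc n)"
      using t e0 corner_dev_nonneg[of v "w @ [i]"]
      by (simp add: ennreal_mult ennreal_plus del: power_Suc)
  qed
  also have "\<dots> = ennreal (\<Sum>i<8. (1 + t) * corner_dev v (w @ [i]) + (1 + 1 / t) * (19208 * ?e) * (1/8) ^ Suc n)"
    using t e0 corner_dev_nonneg by (intro sum_ennreal add_nonneg_nonneg mult_nonneg_nonneg) auto
  finally have "corner_dev v w \<le> (\<Sum>i<8. (1 + t) * corner_dev v (w @ [i]) + (1 + 1 / t) * (19208 * ?e) * (1/8) ^ Suc n)"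
    using t e0 corner_dev_nonneg
    by (subst (asm) ennreal_le_iff) (auto intro!: sum_nonneg add_nonneg_nonneg mult_nonneg_nonneg)
  also have "\<dots> = (1 + t) * (\<Sum>i<8. corner_dev v (w @ [i])) + (1 + 1 / t) * (19208 * (1/8) ^ n * ?e)"
    by (simp add: sum.distrib mult_ac flip: sum_distrib_left)
  finally show ?thesis .
qed

lemma sqrt_corner_dev_step:
  assumes v: "continuous_on carpet v"
  shows "sqrt (\<Sum>w\<in>sc_words n. corner_dev v w)
    \<le> sqrt (\<Sum>w\<in>sc_words (Suc n). corner_dev v w) + sqrt (19208 * (1/8) ^ n * sc_D (Suc n) v)"
proof (rule sqrt_le_of_weighted)
  fix t :: real assume t: "t > 0"
  have "(\<Sum>w\<in>sc_words n. corner_dev v w) \<le> (\<Sum>w\<in>sc_words n. (1 + t) * (\<Sum>i<8. corner_dev v (w @ [i]))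
     + (1 + 1 / t) * (19208 * (1/8) ^ n * (\<Sum>i<8. cell_energy (w @ [i]) v)))"
    by (intro sum_mono corner_dev_step v t)
  also have "\<dots> = (1 + t) * (\<Sum>w\<in>sc_words (Suc n). corner_dev v w) + (1 + 1 / t) * (19208 * (1/8) ^ n * sc_D (Suc n) v)"
    by (simp add: sc_D_eq sum_sc_words_Suc sum.distrib sum_distrib_left)
  finally show "(\<Sum>w\<in>sc_words n. corner_dev v w)
    \<le> (1 + t) * (\<Sum>w\<in>sc_words (Suc n). corner_dev v w) + (1 + 1 / t) * (19208 * (1/8) ^ n * sc_D (Suc n) v)" .
qed (simp_all add: sum_nonneg corner_dev_nonneg sc_D_nonneg)

text \<open>
  Iterating the previous step, \<open>\<surd>\<Phi>\<^sub>n\<close> is bounded by a geometric series with ratio \<open>(8 \<rho>)\<^bsup>-1/2\<^esup> \<le> 1/2\<close>. The remainder vanishes by uniform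
  continuity, which is where continuity of \<open>v\<close> is used. The factor 8 in the ratio comes from the mass of the cells, so the series
  converges much faster than the one for the values of \<open>v\<close> at a point. The constant is \<open>4 \<cdot> 19208\<close>.
\<close>

lemma sum_corner_dev_le:
  assumes v: "continuous_on carpet v" and \<rho>: "1 \<le> \<rho>" and S: "0 \<le> S"
    and D: "\<And>n. n \<ge> 1 \<Longrightarrow> \<rho> ^ n * sc_D n v \<le> S"
  shows "(\<Sum>w\<in>sc_words n. corner_dev v w) \<le> 76832 * S / (8 * \<rho>) ^ n"
proof -
  let ?P = "\<lambda>n. \<Sum>w\<in>sc_words n. corner_dev v w"
  define q where "q = 1 / sqrt (8 * \<rho>)"
  define c where "c = sqrt (19208 * S)"
  have s2: "2 \<le> sqrt (8 * \<rho>)" using \<rho> by (intro real_le_rsqrt) simp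
  then have q: "0 \<le> q" "q \<le> 1/2" unfolding q_def using \<rho> by (auto intro: divide_left_mono[of 2 _ 1, simplified])
  have q2: "q\<^sup>2 = 1 / (8 * \<rho>)" using \<rho> by (simp add: q_def power_divide)
  have "sqrt (?P k) \<le> sqrt (?P (Suc k)) + c * q ^ k" for k
  proof -
    have "\<rho> ^ k * sc_D (Suc k) v \<le> \<rho> ^ Suc k * sc_D (Suc k) v"
      using \<rho> sc_D_nonneg by (intro mult_right_mono) auto
    then have "\<rho> ^ k * sc_D (Suc k) v \<le> S" using D[of "Suc k"] by simp
    then have "sc_D (Suc k) v \<le> S / \<rho> ^ k" using \<rho> by (simp add: field_simps)
    then have "19208 * (1/8) ^ k * sc_D (Suc k) v \<le> 19208 * (1/8) ^ k * (S / \<rho> ^ k)"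
      by (intro mult_left_mono) auto
    also have "\<dots> = (c * q ^ k)\<^sup>2"
      using \<rho> S by (simp add: power_mult_distrib c_def flip: power_mult)
        (simp add: power_mult q2 power_divide power_mult_distrib mult.commute[of k 2])
    finally have "sqrt (19208 * (1/8) ^ k * sc_D (Suc k) v) \<le> c * q ^ k"
      using q S by (intro real_le_lsqrt) (auto simp: c_def)
    then show ?thesis using sqrt_corner_dev_step[OF v, of k] by linarith
  qed
  moreover have "(\<lambda>k. sqrt (?P k)) \<longlonglongrightarrow> 0"
    using tendsto_real_sqrt[OF sum_corner_dev_tendsto_0[OF v]] by simp
  ultimately have "sqrt (?P n) \<le> c * q ^ n / (1 - q)"
    using q by (intro geometric_telescope_bound) auto
  also have "\<dots> \<le> c * q ^ n / (1/2)"
    using q S by (intro divide_left_mono) (auto simp: c_def)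
  finally have "sqrt (?P n) \<le> 2 * c * q ^ n" by simp
  then have "?P n \<le> (2 * c * q ^ n)\<^sup>2"
    by (rule sqrt_le_D)
  also have "\<dots> = 76832 * S / (8 * \<rho>) ^ n"
    using \<rho> S by (simp add: power_mult_distrib c_def flip: power_mult)
      (simp add: power_mult q2 power_divide power_mult_distrib mult.commute[of n 2])
  finally show ?thesis .
qed

text \<open>
  Split \<open>v(x) - v(y)\<close> at the corners of the cells of \<open>x\<close> and \<open>y\<close>.
\<close>

lemma near_energy_cell_le:
  assumes v: "continuous_on carpet v" and w: "w \<in> sc_words n" and x: "x \<in> cell w"
  shows "near_energy n v x \<le> (\<Sum>w'\<in>{w' \<in> sc_words n. neighbours w w'}.
     ennreal (3 * (1/8) ^ n) * ennreal ((v x - v (corner w))\<^sup>2)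
     + ennreal (3 * (1/8) ^ n * (v (corner w) - v (corner w'))\<^sup>2 + 3 * corner_dev v w'))"
proof -
  have [measurable]: "v \<in> borel_measurable sc_nu"
    by (rule borel_measurable_sc_nu_continuous[OF v])
  let ?N = "{w' \<in> sc_words n. neighbours w w'}"
  let ?a = "\<lambda>w'. ennreal (3 * (v x - v (corner w))\<^sup>2 + 3 * (v (corner w) - v (corner w'))\<^sup>2)"
  have pw: "ennreal ((v x - v y)\<^sup>2) * indicator (ball x ((1/3) ^ n)) y
     \<le> (\<Sum>w'\<in>?N. ?a w' * indicator (cell w') y + ennreal 3 * (ennreal ((v y - v (corner w'))\<^sup>2) * indicator (cell w') y))"
    if y: "y \<in> space sc_nu" for y
  proof (cases "dist x y < (1/3) ^ n")
    case True
    obtain w' where w': "w' \<in> sc_words n" "y \<in> cell w'"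
      using y carpet_eq_cells[of n] by auto
    have N: "w' \<in> ?N" using close_cells_neighbours[OF w w'(1) x w'(2) True] w'(1) by simp
    have "(v x - v y)\<^sup>2 \<le> (3 * (v x - v (corner w))\<^sup>2 + 3 * (v (corner w) - v (corner w'))\<^sup>2) + 3 * (v y - v (corner w'))\<^sup>2"
      using square_sum3_le[of "v x - v (corner w)" "v (corner w) - v (corner w')" "v (corner w') - v y"]
      by (simp add: power2_commute[of "v (corner w')"])
    then have "ennreal ((v x - v y)\<^sup>2) \<le> ?a w' + ennreal (3 * (v y - v (corner w'))\<^sup>2)"
      by (subst ennreal_plus[of "3 * (v x - v (corner w))\<^sup>2 + 3 * (v (corner w) - v (corner w'))\<^sup>2", symmetric])
        (simp_all add: ennreal_leI del: ennreal_plus)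
    then have "ennreal ((v x - v y)\<^sup>2) * indicator (ball x ((1/3) ^ n)) y
      \<le> ?a w' * indicator (cell w') y + ennreal 3 * (ennreal ((v y - v (corner w'))\<^sup>2) * indicator (cell w') y)"
      using w'(2) True by (simp add: ennreal_mult del: ennreal_numeral)
    also have "\<dots> \<le> (\<Sum>w'\<in>?N. ?a w' * indicator (cell w') y + ennreal 3 * (ennreal ((v y - v (corner w'))\<^sup>2) * indicator (cell w') y))"
      by (rule member_le_sum[OF N]) auto
    finally show ?thesis .
  qed (simp add: indicator_def)
  have "near_energy n v x \<le> (\<integral>\<^sup>+y. (\<Sum>w'\<in>?N. ?a w' * indicator (cell w') y
      + ennreal 3 * (ennreal ((v y - v (corner w'))\<^sup>2) * indicator (cell w') y)) \<partial>sc_nu)"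
    unfolding near_energy_def by (intro nn_integral_mono pw)
  also have "\<dots> = (\<Sum>w'\<in>?N. \<integral>\<^sup>+y. ?a w' * indicator (cell w') y
      + ennreal 3 * (ennreal ((v y - v (corner w'))\<^sup>2) * indicator (cell w') y) \<partial>sc_nu)"
  proof (rule nn_integral_sum)
    fix w' assume "w' \<in> ?N"
    then have [measurable]: "cell w' \<in> sets sc_nu" using cell_sets by blast
    show "(\<lambda>y. ?a w' * indicator (cell w') y
      + ennreal 3 * (ennreal ((v y - v (corner w'))\<^sup>2) * indicator (cell w') y)) \<in> borel_measurable sc_nu"
      by measurable
  qed
  also have "\<dots> = (\<Sum>w'\<in>?N. ?a w' * ennreal ((1/8) ^ n) + ennreal 3 * ennreal (corner_dev v w'))"
  proof (rule sum.cong[OF refl])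
    fix w' assume "w' \<in> ?N"
    then have w': "w' \<in> sc_words n" by simp
    note [measurable] = cell_sets[OF w']
    show "(\<integral>\<^sup>+y. ?a w' * indicator (cell w') y
      + ennreal 3 * (ennreal ((v y - v (corner w'))\<^sup>2) * indicator (cell w') y) \<partial>sc_nu)
      = ?a w' * ennreal ((1/8) ^ n) + ennreal 3 * ennreal (corner_dev v w')"
      unfolding ennreal_corner_dev[OF v w'] emeasure_cell[OF w', symmetric]
      by (subst nn_integral_add) (simp_all add: nn_integral_cmult nn_integral_cmult_indicator del: ennreal_numeral)
  qed
  also have "\<dots> = (\<Sum>w'\<in>?N. ennreal (3 * (1/8) ^ n) * ennreal ((v x - v (corner w))\<^sup>2)
     + ennreal (3 * (1/8) ^ n * (v (corner w) - v (corner w'))\<^sup>2 + 3 * corner_dev v w'))"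
    by (intro sum.cong refl)
      (simp add: algebra_simps corner_dev_nonneg del: ennreal_numeral flip: ennreal_mult ennreal_plus)
  finally show ?thesis .
qed

lemma nn_integral_near_energy_cell_le:
  assumes v: "continuous_on carpet v" and w: "w \<in> sc_words n"
  shows "(\<integral>\<^sup>+x. near_energy n v x * indicator (cell w) x \<partial>sc_nu)
    \<le> ennreal (\<Sum>w'\<in>{w' \<in> sc_words n. neighbours w w'}.
         3 * (1/8) ^ n * corner_dev v w + 3 * (1/8) ^ n * corner_dev v w'
         + 3 * (1/64) ^ n * (v (corner w) - v (corner w'))\<^sup>2)"
proof -
  have [measurable]: "v \<in> borel_measurable sc_nu"
    by (rule borel_measurable_sc_nu_continuous[OF v])
  note [measurable] = cell_sets[OF w]
  let ?N = "{w' \<in> sc_words n. neighbours w w'}"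
  let ?b = "\<lambda>w'. ennreal (3 * (1/8) ^ n * (v (corner w) - v (corner w'))\<^sup>2 + 3 * corner_dev v w')"
  have "(\<integral>\<^sup>+x. near_energy n v x * indicator (cell w) x \<partial>sc_nu)
     \<le> (\<integral>\<^sup>+x. (\<Sum>w'\<in>?N. ennreal (3 * (1/8) ^ n) * (ennreal ((v x - v (corner w))\<^sup>2) * indicator (cell w) x)
        + ?b w' * indicator (cell w) x) \<partial>sc_nu)"
  proof (rule nn_integral_mono)
    fix x
    show "near_energy n v x * indicator (cell w) x
      \<le> (\<Sum>w'\<in>?N. ennreal (3 * (1/8) ^ n) * (ennreal ((v x - v (corner w))\<^sup>2) * indicator (cell w) x)
        + ?b w' * indicator (cell w) x)"
      using near_energy_cell_le[OF v w, of x] by (cases "x \<in> cell w") simp_all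
  qed
  also have "\<dots> = (\<Sum>w'\<in>?N. ennreal (3 * (1/8) ^ n) * ennreal (corner_dev v w) + ?b w' * ennreal ((1/8) ^ n))"
    unfolding ennreal_corner_dev[OF v w] emeasure_cell[OF w, symmetric]
    by (subst nn_integral_sum, measurable, intro sum.cong refl, subst nn_integral_add)
      (simp_all add: nn_integral_cmult nn_integral_cmult_indicator)
  also have "\<dots> = (\<Sum>w'\<in>?N. ennreal (3 * (1/8) ^ n * corner_dev v w + 3 * (1/8) ^ n * corner_dev v w'
         + 3 * (1/64) ^ n * (v (corner w) - v (corner w'))\<^sup>2))"
  proof (rule sum.cong[OF refl])
    fix w'
    have "(1/8) ^ n * (1/8) ^ n = ((1/64) ^ n :: real)"
      by (simp flip: power_mult_distrib)
    then have "3 * (1/8) ^ n * corner_dev v w + (3 * (1/8) ^ n * (v (corner w) - v (corner w'))\<^sup>2 + 3 * corner_dev v w') * (1/8) ^ n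
        = 3 * (1/8) ^ n * corner_dev v w + 3 * (1/8) ^ n * corner_dev v w'
         + 3 * (1/64) ^ n * (v (corner w) - v (corner w'))\<^sup>2"
      by (simp add: algebra_simps)
    then show "ennreal (3 * (1/8) ^ n) * ennreal (corner_dev v w) + ?b w' * ennreal ((1/8) ^ n)
      = ennreal (3 * (1/8) ^ n * corner_dev v w + 3 * (1/8) ^ n * corner_dev v w'
         + 3 * (1/64) ^ n * (v (corner w) - v (corner w'))\<^sup>2)"
      using corner_dev_nonneg by (simp flip: ennreal_mult ennreal_plus)
  qed
  also have "\<dots> = ennreal (\<Sum>w'\<in>?N. 3 * (1/8) ^ n * corner_dev v w + 3 * (1/8) ^ n * corner_dev v w'
         + 3 * (1/64) ^ n * (v (corner w) - v (corner w'))\<^sup>2)"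
    using corner_dev_nonneg by (intro sum_ennreal) simp
  finally show ?thesis .
qed

text \<open>
  Every cell has at most nine neighbours, so summing over pairs of neighbouring cells costs a factor 9 for each of the
  terms: \<open>54 = 2 \<cdot> 3 \<cdot> 9\<close> and \<open>10584 = 3 \<cdot> 196 \<cdot> 18\<close>.
\<close>

lemma nn_integral_near_energy_le:
  assumes v: "continuous_on carpet v"
  shows "(\<integral>\<^sup>+x. near_energy n v x \<partial>sc_nu)
    \<le> ennreal (54 * (1/8) ^ n * (\<Sum>w\<in>sc_words n. corner_dev v w) + 10584 * (1/64) ^ n * sc_D n v)"
proof -
  let ?N = "\<lambda>w. {w' \<in> sc_words n. neighbours w w'}"
  let ?s = "\<Sum>w\<in>sc_words n. \<Sum>w'\<in>?N w. 3 * (1/8) ^ n * corner_dev v w + 3 * (1/8) ^ n * corner_dev v w'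
         + 3 * (1/64) ^ n * (v (corner w) - v (corner w'))\<^sup>2"
  have "(\<integral>\<^sup>+x. near_energy n v x \<partial>sc_nu) = (\<Sum>w\<in>sc_words n. \<integral>\<^sup>+x. near_energy n v x * indicator (cell w) x \<partial>sc_nu)"
    by (rule nn_integral_cells[symmetric]) (intro near_energy_measurable borel_measurable_sc_nu_continuous v)
  also have "\<dots> \<le> (\<Sum>w\<in>sc_words n. ennreal (\<Sum>w'\<in>?N w. 3 * (1/8) ^ n * corner_dev v w + 3 * (1/8) ^ n * corner_dev v w'
         + 3 * (1/64) ^ n * (v (corner w) - v (corner w'))\<^sup>2))"
    by (intro sum_mono nn_integral_near_energy_cell_le v)
  also have "\<dots> = ennreal ?s"
    using corner_dev_nonneg by (intro sum_ennreal sum_nonneg) simp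
  also have "\<dots> \<le> ennreal (54 * (1/8) ^ n * (\<Sum>w\<in>sc_words n. corner_dev v w) + 10584 * (1/64) ^ n * sc_D n v)"
  proof (rule ennreal_leI)
    have 1: "(\<Sum>w\<in>sc_words n. \<Sum>w'\<in>?N w. 3 * (1/8) ^ n * corner_dev v w) \<le> 9 * (\<Sum>w\<in>sc_words n. 3 * (1/8) ^ n * corner_dev v w)"
      by (rule sum_neighbours_le(1)) (simp add: corner_dev_nonneg)
    have 2: "(\<Sum>w\<in>sc_words n. \<Sum>w'\<in>?N w. 3 * (1/8) ^ n * corner_dev v w') \<le> 9 * (\<Sum>w\<in>sc_words n. 3 * (1/8) ^ n * corner_dev v w)"
      by (rule sum_neighbours_le(2)) (simp add: corner_dev_nonneg)
    have "(\<Sum>w\<in>sc_words n. \<Sum>w'\<in>?N w. (v (corner w) - v (corner w'))\<^sup>2)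
        \<le> (\<Sum>w\<in>sc_words n. \<Sum>w'\<in>?N w. 196 * cell_energy w v + 196 * cell_energy w' v)"
    proof (intro sum_mono)
      fix w w' assume "w \<in> sc_words n" "w' \<in> ?N w"
      then show "(v (corner w) - v (corner w'))\<^sup>2 \<le> 196 * cell_energy w v + 196 * cell_energy w' v"
        using neighbours_energy[of w n w' v] by (simp add: corner_def)
    qed
    also have "\<dots> \<le> 9 * (\<Sum>w\<in>sc_words n. 196 * cell_energy w v) + 9 * (\<Sum>w\<in>sc_words n. 196 * cell_energy w v)"
      unfolding sum.distrib by (intro add_mono sum_neighbours_le) (simp_all add: cell_energy_nonneg)
    also have "\<dots> = 3528 * sc_D n v" by (simp add: sc_D_eq flip: sum_distrib_left)
    finally have 3: "3 * (1/64) ^ n * (\<Sum>w\<in>sc_words n. \<Sum>w'\<in>?N w. (v (corner w) - v (corner w'))\<^sup>2)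
        \<le> 3 * (1/64) ^ n * (3528 * sc_D n v)"
      by (intro mult_left_mono) auto
    have "?s = (\<Sum>w\<in>sc_words n. \<Sum>w'\<in>?N w. 3 * (1/8) ^ n * corner_dev v w)
        + (\<Sum>w\<in>sc_words n. \<Sum>w'\<in>?N w. 3 * (1/8) ^ n * corner_dev v w')
        + 3 * (1/64) ^ n * (\<Sum>w\<in>sc_words n. \<Sum>w'\<in>?N w. (v (corner w) - v (corner w'))\<^sup>2)"
      by (simp only: sum.distrib sum_distrib_left)
    also have "\<dots> \<le> 9 * (\<Sum>w\<in>sc_words n. 3 * (1/8) ^ n * corner_dev v w) + 9 * (\<Sum>w\<in>sc_words n. 3 * (1/8) ^ n * corner_dev v w)
        + 3 * (1/64) ^ n * (3528 * sc_D n v)"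
      by (intro add_mono 1 2 3)
    also have "\<dots> = 54 * (1/8) ^ n * (\<Sum>w\<in>sc_words n. corner_dev v w) + 10584 * (1/64) ^ n * sc_D n v"
      by (simp flip: sum_distrib_left)
    finally show "?s \<le> 54 * (1/8) ^ n * (\<Sum>w\<in>sc_words n. corner_dev v w) + 10584 * (1/64) ^ n * sc_D n v" .
  qed
  finally show ?thesis .
qed

text \<open>
  The constant is \<open>54 \<cdot> 76832 + 10584\<close>.
\<close>

lemma besov_seminorm_le_sup_energy:
  assumes v: "continuous_on carpet v" and \<rho>: "1 \<le> \<rho>"
  shows "besov_seminorm (beta_star \<rho>) v \<le> ennreal 4159512 * sup_energy (beta_star \<rho>) v"
proof (cases "sup_energy (beta_star \<rho>) v")
  case top
  then show ?thesis by (simp add: ennreal_mult_top)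
next
  case (real S)
  have D: "\<rho> ^ n * sc_D n v \<le> S" if "n \<ge> 1" for n
  proof -
    have "ennreal (\<rho> ^ n * sc_D n v) \<le> ennreal S"
      unfolding real(2)[symmetric] using \<rho> that by (subst sup_energy_eq) (auto intro: SUP_upper)
    then show ?thesis using real(1) by (simp add: ennreal_le_iff)
  qed
  have "ennreal ((64 * \<rho>) ^ n) * (\<integral>\<^sup>+x. near_energy n v x \<partial>sc_nu) \<le> ennreal (4159512 * S)" if n: "n \<ge> 1" for n
  proof -
    have "ennreal ((64 * \<rho>) ^ n) * (\<integral>\<^sup>+x. near_energy n v x \<partial>sc_nu)
      \<le> ennreal ((64 * \<rho>) ^ n) * ennreal (54 * (1/8) ^ n * (76832 * S / (8 * \<rho>) ^ n) + 10584 * (1/64) ^ n * (S / \<rho> ^ n))"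
    proof (rule mult_left_mono[OF order_trans[OF nn_integral_near_energy_le[OF v] ennreal_leI]])
      have "sc_D n v \<le> S / \<rho> ^ n" using D[OF n] \<rho> by (simp add: field_simps)
      then show "54 * (1/8) ^ n * (\<Sum>w\<in>sc_words n. corner_dev v w) + 10584 * (1/64) ^ n * sc_D n v
        \<le> 54 * (1/8) ^ n * (76832 * S / (8 * \<rho>) ^ n) + 10584 * (1/64) ^ n * (S / \<rho> ^ n)"
        using sum_corner_dev_le[OF v \<rho> real(1) D] by (intro add_mono mult_left_mono) auto
    qed simp
    also have "\<dots> = ennreal ((64 * \<rho>) ^ n * (54 * (1/8) ^ n * (76832 * S / (8 * \<rho>) ^ n) + 10584 * (1/64) ^ n * (S / \<rho> ^ n)))"
      using \<rho> by (simp add: ennreal_mult')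
    also have "(64 * \<rho>) ^ n * (54 * (1/8) ^ n * (76832 * S / (8 * \<rho>) ^ n) + 10584 * (1/64) ^ n * (S / \<rho> ^ n)) = 4159512 * S"
    proof -
      have "(64::real) ^ n = 8 ^ n * 8 ^ n" by (simp flip: power_mult_distrib)
      then show ?thesis using \<rho> by (simp add: power_mult_distrib power_divide field_simps)
    qed
    finally show ?thesis .
  qed
  then show ?thesis
    using \<rho> real by (subst besov_seminorm_eq) (auto intro!: SUP_least simp: ennreal_mult)
qed

end

section \<open>Averages over cells\<close>

definition cell_mean :: "(point \<Rightarrow> real) \<Rightarrow> nat list \<Rightarrow> real" where
  "cell_mean u w = 8 ^ length w * (\<integral>x. u x * indicator (cell w) x \<partial>sc_nu)"

context carpet_mass
begin

lemma L2_space_integrable: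
  assumes "u \<in> L2_space sc_nu"
  shows "u \<in> borel_measurable sc_nu" "integrable sc_nu u" "integrable sc_nu (\<lambda>x. (u x)\<^sup>2)"
  using assms by (auto simp: L2_space_def intro: square_integrable_imp_integrable)

lemma continuous_in_L2_space:
  assumes v: "continuous_on carpet v"
  shows "v \<in> L2_space sc_nu"
proof -
  have [measurable]: "v \<in> borel_measurable sc_nu"
    by (rule borel_measurable_sc_nu_continuous[OF v])
  have "bounded ((\<lambda>x. (v x)\<^sup>2) ` carpet)"
    by (intro compact_imp_bounded compact_continuous_image continuous_intros v compact_carpet)
  then obtain e where "\<And>x. x \<in> carpet \<Longrightarrow> norm ((v x)\<^sup>2) \<le> e"
    unfolding bounded_iff by blast
  then have "integrable sc_nu (\<lambda>x. (v x)\<^sup>2)"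
    by (intro integrable_const_bound[where B = e]) auto
  then show ?thesis by (simp add: L2_space_def)
qed

text \<open>
  Jensen's inequality. With \<open>m\<close> the average, integrate \<open>(m - c)\<^sup>2 + 2 (m - c) (u - m) \<le> (u - c)\<^sup>2\<close> over the cell; the linear
  term integrates to \<open>0\<close>.
\<close>

lemma cell_mean_deviation:
  assumes u: "u \<in> L2_space sc_nu" and w: "w \<in> sc_words n"
  shows "ennreal ((1/8) ^ n * (cell_mean u w - c)\<^sup>2) \<le> (\<integral>\<^sup>+x. ennreal ((u x - c)\<^sup>2) * indicator (cell w) x \<partial>sc_nu)"
proof -
  note [measurable] = cell_sets[OF w] L2_space_integrable(1)[OF u]
  note int = L2_space_integrable(2,3)[OF u]
  let ?m = "cell_mean u w"
  have mass: "measure sc_nu (cell w) = (1/8) ^ n"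
    using emeasure_cell[OF w] by (simp add: measure_def)
  have iu: "integrable sc_nu (\<lambda>x. u x * indicator (cell w) x)"
    using int(1) by (intro integrable_real_mult_indicator) auto
  have ic: "integrable sc_nu (\<lambda>x. indicator (cell w) x :: real)"
    by (intro integrable_real_indicator) (simp_all add: emeasure_cell[OF w])
  have mean: "(\<integral>x. u x * indicator (cell w) x \<partial>sc_nu) = ?m * (1/8) ^ n"
    by (simp add: cell_mean_def length_sc_words[OF w] power_divide)
  have isq: "integrable sc_nu (\<lambda>x. (u x - c)\<^sup>2 * indicator (cell w) x)"
  proof (rule integrable_real_mult_indicator)
    have "integrable sc_nu (\<lambda>x. (u x)\<^sup>2 - (2 * c) * u x + c\<^sup>2)"
      using int by (intro Bochner_Integration.integrable_add Bochner_Integration.integrable_diff) auto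
    then show "integrable sc_nu (\<lambda>x. (u x - c)\<^sup>2)"
      by (simp add: power2_diff algebra_simps)
  qed simp
  have "(1/8) ^ n * (?m - c)\<^sup>2 = (\<integral>x. (?m - c)\<^sup>2 * indicator (cell w) x
      + 2 * (?m - c) * (u x * indicator (cell w) x - ?m * indicator (cell w) x) \<partial>sc_nu)"
    using iu ic by (simp add: mean mass Int_absorb2[OF cell_subset[OF w]])
  also have "\<dots> \<le> (\<integral>x. (u x - c)\<^sup>2 * indicator (cell w) x \<partial>sc_nu)"
  proof (rule integral_mono[OF _ isq])
    show "integrable sc_nu (\<lambda>x. (?m - c)\<^sup>2 * indicator (cell w) x
      + 2 * (?m - c) * (u x * indicator (cell w) x - ?m * indicator (cell w) x))"
      using iu ic by simp
    fix x
    have "0 \<le> (u x - ?m)\<^sup>2" by simp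
    then have "(?m - c)\<^sup>2 + 2 * (?m - c) * (u x - ?m) \<le> (u x - c)\<^sup>2"
      by (simp add: power2_eq_square algebra_simps)
    then show "(?m - c)\<^sup>2 * indicator (cell w) x
      + 2 * (?m - c) * (u x * indicator (cell w) x - ?m * indicator (cell w) x) \<le> (u x - c)\<^sup>2 * indicator (cell w) x"
      by (simp add: indicator_def)
  qed
  finally have "ennreal ((1/8) ^ n * (?m - c)\<^sup>2) \<le> ennreal (\<integral>x. (u x - c)\<^sup>2 * indicator (cell w) x \<partial>sc_nu)"
    by (rule ennreal_leI)
  also have "\<dots> = (\<integral>\<^sup>+x. ennreal ((u x - c)\<^sup>2 * indicator (cell w) x) \<partial>sc_nu)"
    by (rule nn_integral_eq_integral[symmetric, OF isq]) simp
  also have "\<dots> = (\<integral>\<^sup>+x. ennreal ((u x - c)\<^sup>2) * indicator (cell w) x \<partial>sc_nu)"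
    by (intro nn_integral_cong) (simp add: indicator_def)
  finally show ?thesis .
qed

lemma deviation_le_near_energy:
  assumes u: "u \<in> L2_space sc_nu" and w: "w \<in> sc_words k"
    and near: "\<And>x. x \<in> cell w \<Longrightarrow> dist x y < (1/3) ^ n"
  shows "ennreal ((1/8) ^ k * (cell_mean u w - u y)\<^sup>2) \<le> near_energy n u y"
proof -
  have "ennreal ((1/8) ^ k * (cell_mean u w - u y)\<^sup>2) \<le> (\<integral>\<^sup>+x. ennreal ((u x - u y)\<^sup>2) * indicator (cell w) x \<partial>sc_nu)"
    by (rule cell_mean_deviation[OF u w])
  also have "\<dots> \<le> near_energy n u y"
    unfolding near_energy_def
    by (intro nn_integral_mono) (use near in \<open>auto simp: indicator_def power2_commute dist_commute\<close>)
  finally show ?thesis .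
qed

text \<open>
  Jensen's inequality in each of the two variables. Here \<open>8\<^bsup>k + l\<^esup>\<close> is the inverse of the product of the two masses.
\<close>

lemma cell_mean_diff_le_near_energy:
  assumes u: "u \<in> L2_space sc_nu" and w: "w \<in> sc_words k" "w' \<in> sc_words l"
    and near: "\<And>x y. x \<in> cell w \<Longrightarrow> y \<in> cell w' \<Longrightarrow> dist x y < (1/3) ^ n"
  shows "ennreal ((cell_mean u w - cell_mean u w')\<^sup>2)
    \<le> ennreal (8 ^ (k + l)) * (\<integral>\<^sup>+y. near_energy n u y * indicator (cell w') y \<partial>sc_nu)"
proof -
  note [measurable] = cell_sets[OF w(2)] L2_space_integrable(1)[OF u]
  have "ennreal ((1/8) ^ k) * ennreal ((1/8) ^ l * (cell_mean u w' - cell_mean u w)\<^sup>2)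
    \<le> ennreal ((1/8) ^ k) * (\<integral>\<^sup>+y. ennreal ((u y - cell_mean u w)\<^sup>2) * indicator (cell w') y \<partial>sc_nu)"
    by (intro mult_left_mono cell_mean_deviation u w) simp
  also have "\<dots> = (\<integral>\<^sup>+y. ennreal ((1/8) ^ k) * (ennreal ((u y - cell_mean u w)\<^sup>2) * indicator (cell w') y) \<partial>sc_nu)"
    by (rule nn_integral_cmult[symmetric]) measurable
  also have "\<dots> \<le> (\<integral>\<^sup>+y. near_energy n u y * indicator (cell w') y \<partial>sc_nu)"
  proof (rule nn_integral_mono)
    fix y
    show "ennreal ((1/8) ^ k) * (ennreal ((u y - cell_mean u w)\<^sup>2) * indicator (cell w') y)
      \<le> near_energy n u y * indicator (cell w') y"
      using deviation_le_near_energy[OF u w(1), of y n] near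
      by (cases "y \<in> cell w'") (simp_all add: ennreal_mult power2_commute)
  qed
  finally have le: "ennreal ((1/8) ^ k) * ennreal ((1/8) ^ l * (cell_mean u w' - cell_mean u w)\<^sup>2)
      \<le> (\<integral>\<^sup>+y. near_energy n u y * indicator (cell w') y \<partial>sc_nu)" .
  have "(cell_mean u w - cell_mean u w')\<^sup>2 = 8 ^ (k + l) * ((1/8) ^ k * ((1/8) ^ l * (cell_mean u w' - cell_mean u w)\<^sup>2))"
    by (simp add: power_divide power_add power2_commute[of "cell_mean u w"])
  then have "ennreal ((cell_mean u w - cell_mean u w')\<^sup>2)
      = ennreal (8 ^ (k + l)) * (ennreal ((1/8) ^ k) * ennreal ((1/8) ^ l * (cell_mean u w' - cell_mean u w)\<^sup>2))"
    by (simp only: ennreal_mult[symmetric] zero_le_power zero_le_divide_iff zero_le_numeral zero_le_one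
        zero_le_power2 mult_nonneg_nonneg simp_thms)
  also have "\<dots> \<le> ennreal (8 ^ (k + l)) * (\<integral>\<^sup>+y. near_energy n u y * indicator (cell w') y \<partial>sc_nu)"
    by (intro mult_left_mono le) simp
  finally show ?thesis .
qed

lemma near_energy_le_besov:
  assumes \<rho>: "0 < \<rho>" and B: "besov_seminorm (beta_star \<rho>) u \<le> ennreal B" and n: "n \<ge> 1"
  shows "(\<integral>\<^sup>+x. near_energy n u x \<partial>sc_nu) \<le> ennreal (B / (64 * \<rho>) ^ n)"
proof -
  let ?I = "\<integral>\<^sup>+x. near_energy n u x \<partial>sc_nu"
  have pos: "0 < (64 * \<rho>) ^ n" using \<rho> by simp
  have "ennreal ((64 * \<rho>) ^ n) * ?I \<le> besov_seminorm (beta_star \<rho>) u"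
    using \<rho> n by (subst besov_seminorm_eq) (auto intro: SUP_upper)
  also note B
  finally have "ennreal (1 / (64 * \<rho>) ^ n) * (ennreal ((64 * \<rho>) ^ n) * ?I) \<le> ennreal (1 / (64 * \<rho>) ^ n) * ennreal B"
    by (intro mult_left_mono) auto
  moreover have "ennreal (1 / (64 * \<rho>) ^ n) * ennreal ((64 * \<rho>) ^ n) = 1"
    using pos \<rho> by (subst ennreal_mult[symmetric]) auto
  moreover have "ennreal (1 / (64 * \<rho>) ^ n) * ennreal B = ennreal (B / (64 * \<rho>) ^ n)"
    using pos by (subst ennreal_mult'[symmetric]) auto
  ultimately show ?thesis by (simp flip: mult.assoc)
qed

section \<open>Continuous versions of Besov functions\<close>

text \<open>
  Two cells of level \<open>n + 2\<close> or \<open>n + 3\<close> with points at distance below \<open>3\<^bsup>-(n + 2)\<^esup>\<close> lie together in a set of diameter at most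
  \<open>(3/2 + 1 + 3/2) / 9 \<cdot> 3\<^sup>-\<^sup>n < 3\<^sup>-\<^sup>n\<close>. The shift by two levels is the price for the distance, and \<open>32768 = 8\<^sup>5\<close>.
\<close>

lemma near_cells_mean_diff:
  assumes u: "u \<in> L2_space sc_nu" and \<rho>: "0 < \<rho>" and B0: "0 \<le> B"
    and B: "besov_seminorm (beta_star \<rho>) u \<le> ennreal B" and n: "n \<ge> 1"
    and w: "w \<in> sc_words (n + 2)" "w' \<in> sc_words l" and l: "l = n + 2 \<or> l = n + 3"
    and x: "x \<in> cell w" "y \<in> cell w'" "dist x y < (1/3) ^ (n + 2)"
  shows "\<bar>cell_mean u w - cell_mean u w'\<bar> \<le> sqrt (32768 * B) * (1 / sqrt \<rho>) ^ n"
proof -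
  have near: "dist a b < (1/3) ^ n" if "a \<in> cell w" "b \<in> cell w'" for a b
  proof -
    have "dist a b \<le> dist a x + dist x y + dist y b"
      by (meson dist_triangle order_trans add_right_mono dist_triangle_le)
    also have "\<dots> < 3/2 * (1/3) ^ (n + 2) + (1/3) ^ (n + 2) + 3/2 * (1/3) ^ l"
      using dist_cell[OF w(1) that(1) x(1)] dist_cell[OF w(2) x(2) that(2)] x(3) by linarith
    also have "\<dots> \<le> 3/2 * (1/3) ^ (n + 2) + (1/3) ^ (n + 2) + 3/2 * (1/3) ^ (n + 2)"
      using l by (intro add_left_mono mult_left_mono power_decreasing) auto
    also have "\<dots> < (1/3) ^ n" by simp
    finally show ?thesis .
  qed
  have "ennreal ((cell_mean u w - cell_mean u w')\<^sup>2)
      \<le> ennreal (8 ^ (n + 2 + l)) * (\<integral>\<^sup>+y. near_energy n u y * indicator (cell w') y \<partial>sc_nu)"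
    by (rule cell_mean_diff_le_near_energy[OF u w near])
  also have "\<dots> \<le> ennreal (8 ^ (n + 2 + l)) * (\<integral>\<^sup>+y. near_energy n u y \<partial>sc_nu)"
    by (intro mult_left_mono nn_integral_mono) (auto simp: indicator_def)
  also have "\<dots> \<le> ennreal (8 ^ (n + 2 + l)) * ennreal (B / (64 * \<rho>) ^ n)"
    by (intro mult_left_mono near_energy_le_besov \<rho> B n) simp
  also have "\<dots> = ennreal (8 ^ (n + 2 + l) * (B / (64 * \<rho>) ^ n))"
    by (intro ennreal_mult'[symmetric]) simp
  also have "\<dots> \<le> ennreal (8 ^ (n + 2 + (n + 3)) * (B / (64 * \<rho>) ^ n))"
    using l \<rho> B0 by (intro ennreal_leI mult_right_mono power_increasing) auto
  finally have "(cell_mean u w - cell_mean u w')\<^sup>2 \<le> 8 ^ (n + 2 + (n + 3)) * (B / (64 * \<rho>) ^ n)"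
    using \<rho> B0 by (simp add: ennreal_le_iff)
  also have "\<dots> = 32768 * B / \<rho> ^ n"
  proof -
    have "(64::real) ^ n = 8 ^ n * 8 ^ n" by (simp flip: power_mult_distrib)
    moreover have "(8::real) ^ (n + 2 + (n + 3)) = (8 ^ n * 8 ^ 2) * (8 ^ n * 8 ^ 3)" by (simp only: power_add)
    ultimately have "(8::real) ^ (n + 2 + (n + 3)) = 32768 * 64 ^ n" by simp
    then show ?thesis by (simp only: power_mult_distrib) simp
  qed
  finally have "\<bar>cell_mean u w - cell_mean u w'\<bar>\<^sup>2 \<le> 32768 * B / \<rho> ^ n" by simp
  then have "\<bar>cell_mean u w - cell_mean u w'\<bar> \<le> sqrt (32768 * B / \<rho> ^ n)"
    by (rule real_le_rsqrt)
  then show ?thesis by (simp only: real_sqrt_divide real_sqrt_power power_divide) simp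
qed

text \<open>
  Let \<open>M\<^sub>k(x)\<close> be the average of \<open>u\<close> over a cell of level \<open>k + 3\<close> that contains \<open>x\<close>. Successive averages differ by at most
  \<open>c \<rho>\<^bsup>-k/2\<^esup>\<close>, so they converge uniformly to a function \<open>v\<close>. The averages at points closer than the size of the cells are
  equally close, which makes \<open>v\<close> continuous. Finally \<open>u\<close> and its averages differ by an amount of order \<open>\<rho>\<^sup>-\<^sup>k\<close> in the
  square of the \<open>L\<^sup>2\<close> norm, so \<open>u = v\<close> almost everywhere.
\<close>

lemma besov_continuous_version:
  assumes u: "u \<in> L2_space sc_nu" and \<rho>: "1 < \<rho>" and fin: "besov_seminorm (beta_star \<rho>) u < \<infinity>"
  shows "\<exists>v. continuous_on carpet v \<and> (AE x in sc_nu. u x = v x)"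
proof -
  obtain B where B0: "0 \<le> B" and Beq: "besov_seminorm (beta_star \<rho>) u = ennreal B"
    using fin by (cases "besov_seminorm (beta_star \<rho>) u") auto
  have B: "besov_seminorm (beta_star \<rho>) u \<le> ennreal B" by (simp add: Beq)
  have \<rho>0: "0 < \<rho>" using \<rho> by simp
  note [measurable] = L2_space_integrable(1)[OF u]
  define c where "c = sqrt (32768 * B)"
  define q where "q = 1 / sqrt \<rho>"
  have c: "0 \<le> c" using B0 by (simp add: c_def)
  have q: "0 \<le> q" "q < 1" using \<rho> by (simp_all add: q_def)
  note diff = near_cells_mean_diff[OF u \<rho>0 B0 B, folded c_def q_def]
  \<comment> \<open>a choice among the at most four cells of level \<open>k\<close> containing \<open>x\<close>; any choice gives the same limit\<close>
  define addr where "addr k x = (SOME w. w \<in> sc_words k \<and> x \<in> cell w)" for k x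
  have addr: "addr k x \<in> sc_words k" "x \<in> cell (addr k x)" if "x \<in> carpet" for k x
    using someI_ex[of "\<lambda>w. w \<in> sc_words k \<and> x \<in> cell w"] that carpet_eq_cells[of k]
    unfolding addr_def by blast+
  define M where "M k x = cell_mean u (addr (k + 3) x)" for k x
  have step: "\<bar>M k x - M (Suc k) x\<bar> \<le> (c * q) * q ^ k" if x: "x \<in> carpet" for k x
    unfolding M_def
    using diff[of "Suc k" "addr (k + 3) x" "addr (Suc k + 3) x" "k + 4" x x] addr[OF x]
    by (simp add: mult.assoc numeral_eq_Suc)
  have "\<exists>L. (\<lambda>k. M k x) \<longlonglongrightarrow> L" if x: "x \<in> carpet" for x
  proof -
    have "summable (\<lambda>k. M (Suc k) x - M k x)"
    proof (rule summable_comparison_test')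
      show "summable (\<lambda>k. (c * q) * q ^ k)"
        using q by (intro summable_mult summable_geometric) auto
      show "norm (M (Suc k) x - M k x) \<le> (c * q) * q ^ k" for k
        using step[OF x, of k] by (simp add: abs_minus_commute)
    qed
    from summable_LIMSEQ[OF this] have "(\<lambda>k. M k x - M 0 x) \<longlonglongrightarrow> (\<Sum>k. M (Suc k) x - M k x)"
      unfolding sum_lessThan_telescope[of "\<lambda>k. M k x"] .
    then have "(\<lambda>k. (M k x - M 0 x) + M 0 x) \<longlonglongrightarrow> (\<Sum>k. M (Suc k) x - M k x) + M 0 x"
      by (intro tendsto_intros)
    then show ?thesis by auto
  qed
  then obtain v where v: "\<And>x. x \<in> carpet \<Longrightarrow> (\<lambda>k. M k x) \<longlonglongrightarrow> v x" by metis
  have vM: "\<bar>v x - M k x\<bar> \<le> c * q ^ Suc k / (1 - q)" if x: "x \<in> carpet" for x k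
  proof -
    have "\<bar>v x - M k x\<bar> \<le> (c * q) * q ^ k / (1 - q)"
    proof (rule geometric_telescope_bound[where a = "\<lambda>k. \<bar>v x - M k x\<bar>"])
      show "\<bar>v x - M k x\<bar> \<le> \<bar>v x - M (Suc k) x\<bar> + (c * q) * q ^ k" for k
        using step[OF x, of k] by linarith
      have "(\<lambda>k. \<bar>v x - M k x\<bar>) \<longlonglongrightarrow> \<bar>v x - v x\<bar>"
        by (intro tendsto_intros v x)
      then show "(\<lambda>k. \<bar>v x - M k x\<bar>) \<longlonglongrightarrow> 0" by simp
    qed (use q in auto)
    then show ?thesis by (simp add: mult.assoc)
  qed
  \<comment> \<open>the point \<open>x\<close> need not lie in the cell of \<open>w\<close>: this covers the value of \<open>v\<close> at a nearby point as well\<close>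
  have vm: "\<bar>v x - cell_mean u w\<bar> \<le> 2 * c * q ^ Suc k / (1 - q)"
    if x: "x \<in> carpet" "w \<in> sc_words (k + 3)" "y \<in> cell w" "dist x y < (1/3) ^ (k + 3)" for x y w k
  proof -
    have "\<bar>M k x - cell_mean u w\<bar> \<le> c * q ^ Suc k"
      unfolding M_def
      using diff[of "Suc k" "addr (k + 3) x" w "k + 3" x y] addr[OF x(1)] x by (simp add: numeral_eq_Suc)
    also have "\<dots> \<le> c * q ^ Suc k / (1 - q)"
      using c q by (intro mult_imp_le_div_pos) (auto intro!: mult_left_le)
    finally have "\<bar>M k x - cell_mean u w\<bar> \<le> c * q ^ Suc k / (1 - q)" .
    moreover have "2 * c * q ^ Suc k / (1 - q) = c * q ^ Suc k / (1 - q) + c * q ^ Suc k / (1 - q)" by simp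
    ultimately show ?thesis using vM[OF x(1), of k] by linarith
  qed
  have qlim: "(\<lambda>k. C * q ^ Suc k) \<longlonglongrightarrow> 0" for C
    using tendsto_mult[OF tendsto_const[of C] LIMSEQ_Suc[OF LIMSEQ_realpow_zero[OF q]]] by simp
  have cont: "continuous_on carpet v"
    unfolding continuous_on_iff
  proof (intro ballI allI impI)
    fix x e assume x: "x \<in> carpet" and e: "(e :: real) > 0"
    have "\<forall>\<^sub>F k in sequentially. (4 * c / (1 - q)) * q ^ Suc k < e"
      using order_tendstoD(2)[OF qlim e] .
    then obtain k where k: "(4 * c / (1 - q)) * q ^ Suc k < e"
      unfolding eventually_sequentially by blast
    have "dist (v y) (v x) < e" if y: "y \<in> carpet" "dist y x < (1/3) ^ (k + 3)" for y
      using vm[OF x addr(1)[OF x, of "k + 3"] addr(2)[OF x, of "k + 3"]]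
        vm[OF y(1) addr(1)[OF x, of "k + 3"] addr(2)[OF x, of "k + 3"] y(2)] k
      by (simp add: dist_real_def)
    then show "\<exists>d>0. \<forall>y\<in>carpet. dist y x < d \<longrightarrow> dist (v y) (v x) < e"
      by (intro exI[of _ "(1/3) ^ (k + 3)"]) auto
  qed
  have [measurable]: "v \<in> borel_measurable sc_nu" by (rule borel_measurable_sc_nu_continuous[OF cont])
  define C where "C = (2 * c / (1 - q))\<^sup>2"
  \<comment> \<open>compare both functions with the averages over cells of level \<open>k + 3\<close>\<close>
  have bound: "(\<integral>\<^sup>+x. ennreal ((u x - v x)\<^sup>2) \<partial>sc_nu) \<le> ennreal (16 * B * (1 / \<rho>) ^ Suc k + 2 * C * (1 / \<rho>) ^ Suc k)" for k
  proof -
    have cellwise: "(\<integral>\<^sup>+x. ennreal ((u x - v x)\<^sup>2) * indicator (cell w) x \<partial>sc_nu)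
        \<le> ennreal (2 * 8 ^ (k + 3)) * (\<integral>\<^sup>+x. near_energy (k + 2) u x * indicator (cell w) x \<partial>sc_nu)
          + ennreal (2 * C * (1 / \<rho>) ^ Suc k * (1/8) ^ (k + 3))" if w: "w \<in> sc_words (k + 3)" for w
    proof -
      note [measurable] = cell_sets[OF w]
      have near: "dist x y < (1/3) ^ (k + 2)" if "x \<in> cell w" "y \<in> cell w" for x y
      proof -
        have "dist x y \<le> 3/2 * (1/3) ^ (k + 3)" by (rule dist_cell[OF w that])
        also have "\<dots> < (1/3) ^ (k + 2)" by (simp add: numeral_eq_Suc)
        finally show ?thesis .
      qed
      have "(\<integral>\<^sup>+x. ennreal ((u x - v x)\<^sup>2) * indicator (cell w) x \<partial>sc_nu)
        \<le> (\<integral>\<^sup>+x. ennreal (2 * 8 ^ (k + 3)) * (near_energy (k + 2) u x * indicator (cell w) x)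
           + ennreal (2 * C * (1 / \<rho>) ^ Suc k) * indicator (cell w) x \<partial>sc_nu)"
      proof (rule nn_integral_mono)
        fix x
        show "ennreal ((u x - v x)\<^sup>2) * indicator (cell w) x
          \<le> ennreal (2 * 8 ^ (k + 3)) * (near_energy (k + 2) u x * indicator (cell w) x)
           + ennreal (2 * C * (1 / \<rho>) ^ Suc k) * indicator (cell w) x"
        proof (cases "x \<in> cell w")
          case True
          let ?a = "cell_mean u w - u x" and ?b = "v x - cell_mean u w"
          have "x \<in> carpet" using True cell_subset[OF w] by blast
          then have "\<bar>?b\<bar> \<le> 2 * c * q ^ Suc k / (1 - q)"
            using vm[of x w k x] w True by simp
          then have "?b\<^sup>2 \<le> (2 * c * q ^ Suc k / (1 - q))\<^sup>2"
            by (metis abs_ge_zero power_mono power2_abs)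
          also have "\<dots> = C * (q\<^sup>2) ^ Suc k"
            by (simp only: C_def power_mult[symmetric] power_divide power_mult_distrib mult.commute[of 2 "Suc k"] times_divide_eq_left)
          also have "q\<^sup>2 = 1 / \<rho>" using \<rho> by (simp add: q_def power_divide)
          finally have b: "?b\<^sup>2 \<le> C * (1 / \<rho>) ^ Suc k" .
          have "(u x - v x)\<^sup>2 = (?a + ?b)\<^sup>2" by (simp add: power2_commute)
          also have "\<dots> \<le> 2 * ?a\<^sup>2 + 2 * ?b\<^sup>2"
            using weighted_square_sum[of 1 ?a ?b] by simp
          also have "\<dots> \<le> 2 * 8 ^ (k + 3) * ((1/8) ^ (k + 3) * ?a\<^sup>2) + 2 * C * (1 / \<rho>) ^ Suc k"
            using b by (simp add: power_divide)
          finally have "ennreal ((u x - v x)\<^sup>2) \<le> ennreal (2 * 8 ^ (k + 3) * ((1/8) ^ (k + 3) * ?a\<^sup>2) + 2 * C * (1 / \<rho>) ^ Suc k)"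
            by (rule ennreal_leI)
          also have "\<dots> = ennreal (2 * 8 ^ (k + 3) * ((1/8) ^ (k + 3) * ?a\<^sup>2)) + ennreal (2 * C * (1 / \<rho>) ^ Suc k)"
            using \<rho> by (intro ennreal_plus) (simp_all add: C_def)
          also have "ennreal (2 * 8 ^ (k + 3) * ((1/8) ^ (k + 3) * ?a\<^sup>2)) = ennreal (2 * 8 ^ (k + 3)) * ennreal ((1/8) ^ (k + 3) * ?a\<^sup>2)"
            by (intro ennreal_mult) simp_all
          also have "\<dots> + ennreal (2 * C * (1 / \<rho>) ^ Suc k) \<le> ennreal (2 * 8 ^ (k + 3)) * near_energy (k + 2) u x + ennreal (2 * C * (1 / \<rho>) ^ Suc k)"
            using near True by (intro add_right_mono mult_left_mono deviation_le_near_energy u w) auto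
          finally show ?thesis using True by simp
        qed simp
      qed
      also have "\<dots> = ennreal (2 * 8 ^ (k + 3)) * (\<integral>\<^sup>+x. near_energy (k + 2) u x * indicator (cell w) x \<partial>sc_nu)
          + ennreal (2 * C * (1 / \<rho>) ^ Suc k) * ennreal ((1/8) ^ (k + 3))"
        unfolding emeasure_cell[OF w, symmetric]
        by (subst nn_integral_add) (simp_all add: nn_integral_cmult nn_integral_cmult_indicator)
      also have "ennreal (2 * C * (1 / \<rho>) ^ Suc k) * ennreal ((1/8) ^ (k + 3)) = ennreal (2 * C * (1 / \<rho>) ^ Suc k * (1/8) ^ (k + 3))"
        using \<rho> by (intro ennreal_mult[symmetric]) (simp_all add: C_def)
      finally show ?thesis .
    qed
    have "(\<integral>\<^sup>+x. ennreal ((u x - v x)\<^sup>2) \<partial>sc_nu) = (\<Sum>w\<in>sc_words (k + 3). \<integral>\<^sup>+x. ennreal ((u x - v x)\<^sup>2) * indicator (cell w) x \<partial>sc_nu)"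
      by (rule nn_integral_cells[symmetric]) measurable
    also have "\<dots> \<le> (\<Sum>w\<in>sc_words (k + 3). ennreal (2 * 8 ^ (k + 3)) * (\<integral>\<^sup>+x. near_energy (k + 2) u x * indicator (cell w) x \<partial>sc_nu)
          + ennreal (2 * C * (1 / \<rho>) ^ Suc k * (1/8) ^ (k + 3)))"
      by (intro sum_mono cellwise)
    also have "\<dots> = ennreal (2 * 8 ^ (k + 3)) * (\<integral>\<^sup>+x. near_energy (k + 2) u x \<partial>sc_nu)
        + (\<Sum>w\<in>sc_words (k + 3). ennreal (2 * C * (1 / \<rho>) ^ Suc k * (1/8) ^ (k + 3)))"
      by (simp add: sum.distrib nn_integral_cells flip: sum_distrib_left)
    also have "(\<Sum>w\<in>sc_words (k + 3). ennreal (2 * C * (1 / \<rho>) ^ Suc k * (1/8) ^ (k + 3))) = ennreal (2 * C * (1 / \<rho>) ^ Suc k)"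
      using \<rho> by (subst sum_ennreal) (simp_all add: C_def card_sc_words power_divide)
    also have "ennreal (2 * 8 ^ (k + 3)) * (\<integral>\<^sup>+x. near_energy (k + 2) u x \<partial>sc_nu) \<le> ennreal (2 * 8 ^ (k + 3)) * ennreal (B / (64 * \<rho>) ^ (k + 2))"
      by (intro mult_left_mono near_energy_le_besov \<rho>0 B) simp_all
    also have "\<dots> = ennreal (2 * 8 ^ (k + 3) * (B / (64 * \<rho>) ^ (k + 2)))"
      by (intro ennreal_mult'[symmetric]) simp
    also have "\<dots> \<le> ennreal (16 * B * (1 / \<rho>) ^ Suc k)"
    proof (rule ennreal_leI)
      have "8 ^ (k + 3) * (\<rho> ^ Suc k) \<le> 8 * (64 * \<rho>) ^ (k + 2)"
      proof -
        have "(8::real) ^ (k + 3) * (\<rho> ^ Suc k) = 8 * (8 ^ (k + 2) * \<rho> ^ Suc k)" by (simp add: numeral_eq_Suc)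
        also have "\<dots> \<le> 8 * (64 ^ (k + 2) * \<rho> ^ (k + 2))"
          using \<rho> by (intro mult_left_mono mult_mono power_mono power_increasing) auto
        finally show ?thesis by (simp only: power_mult_distrib)
      qed
      then have "8 ^ (k + 3) / (64 * \<rho>) ^ (k + 2) \<le> 8 * (1 / \<rho>) ^ Suc k"
        using \<rho> by (simp add: divide_le_eq power_divide le_divide_eq)
      then have "(2 * B) * (8 ^ (k + 3) / (64 * \<rho>) ^ (k + 2)) \<le> (2 * B) * (8 * (1 / \<rho>) ^ Suc k)"
        using B0 by (intro mult_left_mono) auto
      then show "2 * 8 ^ (k + 3) * (B / (64 * \<rho>) ^ (k + 2)) \<le> 16 * B * (1 / \<rho>) ^ Suc k"
        by (simp add: mult_ac)
    qed
    also have "ennreal (16 * B * (1 / \<rho>) ^ Suc k) + ennreal (2 * C * (1 / \<rho>) ^ Suc k)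
        = ennreal (16 * B * (1 / \<rho>) ^ Suc k + 2 * C * (1 / \<rho>) ^ Suc k)"
      using \<rho> B0 by (intro ennreal_plus[symmetric]) (simp_all add: C_def)
    finally show ?thesis by (simp add: add_right_mono)
  qed
  have "(\<lambda>k. (1 / \<rho>) ^ Suc k) \<longlonglongrightarrow> 0"
    using \<rho> by (intro LIMSEQ_Suc LIMSEQ_realpow_zero) auto
  then have "(\<lambda>k. 16 * B * (1 / \<rho>) ^ Suc k + 2 * C * (1 / \<rho>) ^ Suc k) \<longlonglongrightarrow> 16 * B * 0 + 2 * C * 0"
    by (intro tendsto_intros)
  then have "(\<lambda>k. ennreal (16 * B * (1 / \<rho>) ^ Suc k + 2 * C * (1 / \<rho>) ^ Suc k)) \<longlonglongrightarrow> ennreal (16 * B * 0 + 2 * C * 0)"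
    by (rule tendsto_ennrealI)
  then have "(\<integral>\<^sup>+x. ennreal ((u x - v x)\<^sup>2) \<partial>sc_nu) \<le> ennreal (16 * B * 0 + 2 * C * 0)"
    by (rule tendsto_lowerbound) (rule always_eventually, rule allI, rule bound, simp)
  then have "(\<integral>\<^sup>+x. ennreal ((u x - v x)\<^sup>2) \<partial>sc_nu) = 0" by simp
  then have "AE x in sc_nu. ennreal ((u x - v x)\<^sup>2) = 0"
    by (subst (asm) nn_integral_0_iff_AE) auto
  then have "AE x in sc_nu. u x = v x" by (auto simp: ennreal_eq_0_iff)
  with cont show ?thesis by blast
qed

section \<open>From the Besov seminorm to discrete energies\<close>

lemma cell_mean_near_value:
  assumes v: "continuous_on carpet v" and w: "w \<in> sc_words n" and e: "\<And>x. x \<in> cell w \<Longrightarrow> \<bar>v x - c\<bar> \<le> e"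
  shows "(cell_mean v w - c)\<^sup>2 \<le> e\<^sup>2"
proof -
  have "ennreal ((1/8) ^ n * (cell_mean v w - c)\<^sup>2) \<le> (\<integral>\<^sup>+x. ennreal ((v x - c)\<^sup>2) * indicator (cell w) x \<partial>sc_nu)"
    by (intro cell_mean_deviation continuous_in_L2_space v w)
  also have "\<dots> \<le> (\<integral>\<^sup>+x. ennreal (e\<^sup>2) * indicator (cell w) x \<partial>sc_nu)"
  proof (rule nn_integral_mono)
    fix x
    show "ennreal ((v x - c)\<^sup>2) * indicator (cell w) x \<le> ennreal (e\<^sup>2) * indicator (cell w) x"
    proof (cases "x \<in> cell w")
      case True
      have "\<bar>v x - c\<bar> \<le> \<bar>e\<bar>" using e[OF True] by simp
      then have "(v x - c)\<^sup>2 \<le> e\<^sup>2" by (rule abs_le_square_iff[THEN iffD1])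
      then show ?thesis using True by (simp add: ennreal_leI)
    qed simp
  qed
  also have "\<dots> = ennreal (e\<^sup>2) * ennreal ((1/8) ^ n)"
    using w by (simp add: nn_integral_cmult_indicator cell_sets emeasure_cell)
  also have "\<dots> = ennreal ((1/8) ^ n * e\<^sup>2)"
    by (simp add: ennreal_mult mult.commute)
  finally have "(1/8) ^ n * (cell_mean v w - c)\<^sup>2 \<le> (1/8) ^ n * e\<^sup>2"
    by (subst (asm) ennreal_le_iff) simp_all
  then show ?thesis by (subst (asm) mult_le_cancel_left_pos) simp_all
qed

lemma ennreal_sum_le_near_energy:
  assumes \<rho>: "0 < \<rho>" and B0: "0 \<le> B" and B: "besov_seminorm (beta_star \<rho>) u \<le> ennreal B" and u: "u \<in> L2_space sc_nu"
    and k: "k \<ge> 1" and C: "0 \<le> C"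
    and g: "\<And>w i. w \<in> sc_words n \<Longrightarrow> i < 8 \<Longrightarrow> ennreal (g w i)
        \<le> ennreal C * (\<integral>\<^sup>+x. near_energy k u x * indicator (cell (w @ [i])) x \<partial>sc_nu)"
    and g0: "\<And>w i. 0 \<le> g w i"
  shows "(\<Sum>w\<in>sc_words n. \<Sum>i<8. g w i) \<le> C * (B / (64 * \<rho>) ^ k)"
proof -
  have "ennreal (\<Sum>w\<in>sc_words n. \<Sum>i<8. g w i) = (\<Sum>w\<in>sc_words n. \<Sum>i<8. ennreal (g w i))"
    using g0 by (simp add: sum_nonneg)
  also have "\<dots> \<le> (\<Sum>w\<in>sc_words n. \<Sum>i<8. ennreal C * (\<integral>\<^sup>+x. near_energy k u x * indicator (cell (w @ [i])) x \<partial>sc_nu))"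
    by (intro sum_mono g) auto
  also have "\<dots> = ennreal C * (\<Sum>w\<in>sc_words (Suc n). \<integral>\<^sup>+x. near_energy k u x * indicator (cell w) x \<partial>sc_nu)"
    by (simp add: sum_sc_words_Suc sum_distrib_left)
  also have "\<dots> = ennreal C * (\<integral>\<^sup>+x. near_energy k u x \<partial>sc_nu)"
    by (subst nn_integral_cells) (simp_all add: near_energy_measurable L2_space_integrable(1)[OF u])
  also have "\<dots> \<le> ennreal C * ennreal (B / (64 * \<rho>) ^ k)"
    by (intro mult_left_mono near_energy_le_besov \<rho> B k) simp
  also have "\<dots> = ennreal (C * (B / (64 * \<rho>) ^ k))"
    using C by (intro ennreal_mult'[symmetric])
  finally show ?thesis
    using C B0 \<rho> by (subst (asm) ennreal_le_iff) simp_all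
qed

text \<open>
  The word \<open>r k (w, i) = w i i \<dots> i\<close> with \<open>k + 1\<close> letters \<open>i\<close> names a decreasing sequence of cells around the point \<open>f\<^sub>w(p\<^sub>i)\<close>. In the
  \<open>\<ell>\<^sup>2\<close> norm over all pairs \<open>(w, i)\<close> the averages over consecutive cells of this sequence differ by at most \<open>c \<rho>\<^bsup>-(n + k)/2\<^esup>\<close>. The set of
  pairs is fixed and finite, so convergence at each point suffices for the norm to tend to \<open>0\<close>.
\<close>

lemma sum_vertex_mean_le:
  assumes v: "continuous_on carpet v" and \<rho>: "7/6 \<le> \<rho>" and B0: "0 \<le> B"
    and B: "besov_seminorm (beta_star \<rho>) v \<le> ennreal B" and n: "n \<ge> 1"
  shows "(\<Sum>w\<in>sc_words n. \<Sum>i<8. (v (sc_f_word w (sc_p i)) - cell_mean v (w @ [i]))\<^sup>2) \<le> 100352 * B / \<rho> ^ n"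
proof -
  have \<rho>0: "0 < \<rho>" "1 \<le> \<rho>" using \<rho> by simp_all
  have u: "v \<in> L2_space sc_nu" by (rule continuous_in_L2_space[OF v])
  let ?W = "sc_words n \<times> {..<8::nat}"
  define r where "r k z = fst z @ replicate (Suc k) (snd z)" for k and z :: "nat list \<times> nat"
  have r: "r k z \<in> sc_words (n + Suc k)" if "z \<in> ?W" for k z
    using that by (auto simp: r_def sc_words_def)
  have r_snoc: "r (Suc k) z = r k z @ [snd z]" for k z
    by (simp add: r_def replicate_append_same flip: replicate_Suc)
  have r_sub: "cell (r k z) \<subseteq> cell (fst z @ [snd z])" if "z \<in> ?W" for k z
  proof (induction k)
    case (Suc k)
    have "cell (r (Suc k) z) \<subseteq> cell (r k z)"
      unfolding r_snoc using cell_split[of "r k z"] that by auto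
    with Suc show ?case by blast
  qed (simp add: r_def)
  define p where "p z = sc_f_word (fst z) (sc_p (snd z))" for z :: "nat list \<times> nat"
  have fix_rep: "sc_f_word (replicate m i) (sc_p i) = sc_p i" for m i
    by (induction m) (simp_all add: sc_f_word_Cons sc_f_fixed)
  have p: "p z \<in> cell (r k z)" if "z \<in> ?W" for k z
  proof -
    have "p z = sc_f_word (r k z) (sc_p (snd z))"
      by (simp only: p_def r_def sc_f_word_append comp_apply fix_rep)
    then show ?thesis using that by (auto simp: sc_f_word_in_cell sc_p_carpet)
  qed
  define X where "X k = L2_set (\<lambda>z. v (p z) - cell_mean v (r k z)) ?W" for k
  define q where "q = 1 / sqrt \<rho>"
  define c where "c = sqrt (512 * B) * q ^ n"
  \<comment> \<open>\<open>13/14\<close> is a rational upper bound for \<open>(6/7)\<^bsup>1/2\<^esup>\<close>; it produces the factor \<open>196 = 14\<^sup>2\<close> in the constant\<close>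
  have q: "0 \<le> q" "q \<le> 13/14"
  proof -
    have "14/13 \<le> sqrt \<rho>" using \<rho> by (intro real_le_rsqrt) (simp add: power2_eq_square)
    then show "0 \<le> q" "q \<le> 13/14" using \<rho>0 by (simp_all add: q_def divide_le_eq)
  qed
  have q2: "q\<^sup>2 = 1 / \<rho>" using \<rho>0 by (simp add: q_def power_divide)
  have step: "X k \<le> X (Suc k) + c * q ^ k" for k
  proof -
    have "X k = L2_set (\<lambda>z. (v (p z) - cell_mean v (r (Suc k) z)) + (cell_mean v (r (Suc k) z) - cell_mean v (r k z))) ?W"
      by (simp add: X_def)
    also have "\<dots> \<le> X (Suc k) + L2_set (\<lambda>z. cell_mean v (r (Suc k) z) - cell_mean v (r k z)) ?W"
      unfolding X_def by (rule L2_set_triangle_ineq)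
    also have "L2_set (\<lambda>z. cell_mean v (r (Suc k) z) - cell_mean v (r k z)) ?W \<le> c * q ^ k"
    proof -
      have "(\<Sum>w\<in>sc_words n. \<Sum>i<8. (cell_mean v (r (Suc k) (w, i)) - cell_mean v (r k (w, i)))\<^sup>2)
          \<le> 8 ^ ((n + Suc (Suc k)) + (n + Suc k)) * (B / (64 * \<rho>) ^ (n + k))"
      proof (rule ennreal_sum_le_near_energy[OF \<rho>0(1) B0 B u])
        show "1 \<le> n + k" using n by simp
        fix w and i :: nat assume w: "w \<in> sc_words n" and i: "i < 8"
        then have z: "(w, i) \<in> ?W" by simp
        have near: "dist x y < (1/3) ^ (n + k)" if "x \<in> cell (r (Suc k) (w, i))" "y \<in> cell (r k (w, i))" for x y
        proof -
          have "x \<in> cell (r k (w, i))" using that(1) cell_split[of "r k (w, i)"] i by (auto simp: r_snoc)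
          then have "dist x y \<le> 3/2 * (1/3) ^ (n + Suc k)" using dist_cell[OF r[OF z]] that(2) by blast
          also have "\<dots> < (1/3) ^ (n + k)" by simp
          finally show ?thesis .
        qed
        have "ennreal ((cell_mean v (r (Suc k) (w, i)) - cell_mean v (r k (w, i)))\<^sup>2)
          \<le> ennreal (8 ^ ((n + Suc (Suc k)) + (n + Suc k))) * (\<integral>\<^sup>+x. near_energy (n + k) v x * indicator (cell (r k (w, i))) x \<partial>sc_nu)"
          by (rule cell_mean_diff_le_near_energy[OF u r[OF z] r[OF z] near])
        also have "\<dots> \<le> ennreal (8 ^ ((n + Suc (Suc k)) + (n + Suc k))) * (\<integral>\<^sup>+x. near_energy (n + k) v x * indicator (cell (w @ [i])) x \<partial>sc_nu)"
          using r_sub[OF z, of k] by (intro mult_left_mono nn_integral_mono) (auto simp: indicator_def)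
        finally show "ennreal ((cell_mean v (r (Suc k) (w, i)) - cell_mean v (r k (w, i)))\<^sup>2)
          \<le> ennreal (8 ^ ((n + Suc (Suc k)) + (n + Suc k))) * (\<integral>\<^sup>+x. near_energy (n + k) v x * indicator (cell (w @ [i])) x \<partial>sc_nu)" .
      qed simp_all
      also have "\<dots> = 512 * B * (1 / \<rho>) ^ (n + k)"
      proof -
        have "(n + Suc (Suc k)) + (n + Suc k) = 3 + 2 * (n + k)" by simp
        then have "(8::real) ^ ((n + Suc (Suc k)) + (n + Suc k)) = 512 * 64 ^ (n + k)"
          by (simp only: power_add power_mult) simp
        then show ?thesis by (simp only: power_mult_distrib) (simp add: power_divide)
      qed
      also have "\<dots> = (c * q ^ k)\<^sup>2"
      proof -
        have "(c * q ^ k)\<^sup>2 = (sqrt (512 * B))\<^sup>2 * (q\<^sup>2) ^ (n + k)"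
          by (simp only: c_def power_mult_distrib power_mult[symmetric] mult.commute[of 2] power_add ring_distribs mult.assoc)
        then show ?thesis using B0 by (simp add: q2)
      qed
      finally have "L2_set (\<lambda>z. cell_mean v (r (Suc k) z) - cell_mean v (r k z)) ?W \<le> sqrt ((c * q ^ k)\<^sup>2)"
        unfolding L2_set_def by (intro real_sqrt_le_mono) (simp add: sum.cartesian_product case_prod_unfold)
      then show ?thesis using q B0 by (simp add: c_def)
    qed
    finally show ?thesis by simp
  qed
  have conv: "(\<lambda>k. cell_mean v (r k z)) \<longlonglongrightarrow> v (p z)" if z: "z \<in> ?W" for z
  proof (rule LIMSEQ_I)
    fix e :: real assume e: "e > 0"
    obtain N where N: "\<forall>m\<ge>N. \<forall>w\<in>sc_words m. \<forall>x\<in>cell w. \<forall>y\<in>cell w. \<bar>v x - v y\<bar> < e / 2"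
      using continuous_carpet_cells[OF v, of "e / 2"] e by auto
    have "norm (cell_mean v (r k z) - v (p z)) < e" if k: "k \<ge> N" for k
    proof -
      have "(cell_mean v (r k z) - v (p z))\<^sup>2 \<le> (e / 2)\<^sup>2"
      proof (rule cell_mean_near_value[OF v r[OF z]])
        fix x assume "x \<in> cell (r k z)"
        then show "\<bar>v x - v (p z)\<bar> \<le> e / 2"
          using N[rule_format, of "n + Suc k" "r k z" x "p z"] r[OF z] p[OF z] k by (simp add: less_imp_le)
      qed
      then have "\<bar>cell_mean v (r k z) - v (p z)\<bar> \<le> \<bar>e / 2\<bar>" by (rule abs_le_square_iff[THEN iffD2])
      then show ?thesis using e by simp
    qed
    then show "\<exists>N. \<forall>k\<ge>N. norm (cell_mean v (r k z) - v (p z)) < e" by blast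
  qed
  have "X \<longlonglongrightarrow> sqrt (\<Sum>z\<in>?W. (v (p z) - v (p z))\<^sup>2)"
    unfolding X_def L2_set_def by (intro tendsto_intros conv)
  then have "X \<longlonglongrightarrow> 0" by simp
  then have "X 0 \<le> c * q ^ 0 / (1 - q)"
    using q by (intro geometric_telescope_bound step) auto
  also have "\<dots> \<le> c * 14"
  proof -
    have "c * 1 \<le> c * (14 * (1 - q))"
      using q B0 by (intro mult_left_mono) (auto simp: c_def)
    then show ?thesis using q by (simp add: divide_le_eq algebra_simps)
  qed
  finally have "(X 0)\<^sup>2 \<le> (c * 14)\<^sup>2"
    unfolding X_def by (intro power_mono L2_set_nonneg)
  also have "\<dots> = 100352 * B / \<rho> ^ n"
  proof -
    have "(c * 14)\<^sup>2 = (sqrt (512 * B))\<^sup>2 * (q\<^sup>2) ^ n * 196"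
      by (simp only: c_def power_mult_distrib power_mult[symmetric] mult.commute[of 2]) simp
    then show ?thesis using B0 by (simp add: q2 power_divide)
  qed
  also have "(X 0)\<^sup>2 = (\<Sum>z\<in>?W. (v (p z) - cell_mean v (r 0 z))\<^sup>2)"
    unfolding X_def L2_set_def by (intro real_sqrt_pow2 sum_nonneg) simp
  also have "\<dots> = (\<Sum>w\<in>sc_words n. \<Sum>i<8. (v (sc_f_word w (sc_p i)) - cell_mean v (w @ [i]))\<^sup>2)"
    by (simp add: p_def r_def sum.cartesian_product case_prod_unfold)
  finally show ?thesis .
qed

text \<open>
  Split the difference of \<open>v\<close> along an edge of the cell \<open>w\<close> at the averages over the two subcells at its end points, whose points
  are closer than \<open>3\<^sup>-\<^sup>n\<close>. The constant is \<open>24 \<cdot> 100352 + (3/2) \<cdot> 512\<close>.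
\<close>

lemma sc_D_le_besov:
  assumes v: "continuous_on carpet v" and \<rho>: "7/6 \<le> \<rho>" and B0: "0 \<le> B"
    and B: "besov_seminorm (beta_star \<rho>) v \<le> ennreal B" and n: "n \<ge> 1"
  shows "sc_D n v \<le> 2409216 * B / \<rho> ^ n"
proof -
  have \<rho>0: "0 < \<rho>" using \<rho> by simp
  have u: "v \<in> L2_space sc_nu" by (rule continuous_in_L2_space[OF v])
  let ?P = "\<lambda>i j. dist (sc_p i) (sc_p j) = 1/2"
  let ?m = "\<lambda>w i. cell_mean v (w @ [i])"
  let ?a = "\<lambda>w i. (v (sc_f_word w (sc_p i)) - ?m w i)\<^sup>2"
  let ?b = "\<lambda>w i j. if ?P i j then (?m w i - ?m w j)\<^sup>2 else 0"
  have energy: "cell_energy w v \<le> 24 * (\<Sum>i<8. ?a w i) + 3/2 * (\<Sum>j<8. \<Sum>i<8. ?b w i j)" for w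
  proof -
    have "(\<Sum>(i, j)\<in>{(i, j). i < 8 \<and> j < 8 \<and> ?P i j}. (v (sc_f_word w (sc_p i)) - v (sc_f_word w (sc_p j)))\<^sup>2)
        \<le> (\<Sum>i<8. \<Sum>j<8. 3 * ?a w i + 3 * ?b w i j + 3 * ?a w j)"
    proof (rule sum_neighbour_pairs_le)
      fix i j assume P: "?P i j"
      show "(v (sc_f_word w (sc_p i)) - v (sc_f_word w (sc_p j)))\<^sup>2 \<le> 3 * ?a w i + 3 * ?b w i j + 3 * ?a w j"
        using square_sum3_le[of "v (sc_f_word w (sc_p i)) - ?m w i" "?m w i - ?m w j" "?m w j - v (sc_f_word w (sc_p j))"] P
        by (simp add: power2_commute[of "?m w j" "v (sc_f_word w (sc_p j))"])
    qed simp
    also have "\<dots> = 48 * (\<Sum>i<8. ?a w i) + 3 * (\<Sum>i<8. \<Sum>j<8. ?b w i j)"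
      by (simp add: sum.distrib flip: sum_distrib_left)
    also have "(\<Sum>i<8. \<Sum>j<8. ?b w i j) = (\<Sum>j<8. \<Sum>i<8. ?b w i j)"
      by (rule sum.swap)
    finally show ?thesis unfolding cell_energy_def by simp
  qed
  have "(\<Sum>w\<in>sc_words n. \<Sum>j<8. \<Sum>i<8. ?b w i j) = (\<Sum>i<8. \<Sum>w\<in>sc_words n. \<Sum>j<8. ?b w i j)"
    by (subst sum.swap, subst (2) sum.swap) (rule refl)
  also have "\<dots> \<le> (\<Sum>i<8::nat. 64 * B / \<rho> ^ n)"
  proof (rule sum_mono)
    fix i :: nat assume "i \<in> {..<8}"
    then have i: "i < 8" by simp
    have "(\<Sum>w\<in>sc_words n. \<Sum>j<8. ?b w i j) \<le> 8 ^ (Suc n + Suc n) * (B / (64 * \<rho>) ^ n)"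
    proof (rule ennreal_sum_le_near_energy[OF \<rho>0 B0 B u n])
      fix w and j :: nat assume w: "w \<in> sc_words n" and j: "j < 8"
      show "ennreal (?b w i j) \<le> ennreal (8 ^ (Suc n + Suc n)) * (\<integral>\<^sup>+x. near_energy n v x * indicator (cell (w @ [j])) x \<partial>sc_nu)"
      proof (cases "?P i j")
        case True
        have "ennreal ((?m w i - ?m w j)\<^sup>2) \<le> ennreal (8 ^ (Suc n + Suc n)) * (\<integral>\<^sup>+x. near_energy n v x * indicator (cell (w @ [j])) x \<partial>sc_nu)"
          using adjacent_children_near[OF w i j True]
          by (intro cell_mean_diff_le_near_energy u sc_words_snocI w i j)
        then show ?thesis using True by simp
      qed simp
    qed simp_all
    also have "\<dots> = 64 * B / \<rho> ^ n"
    proof -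
      have "Suc n + Suc n = 2 + 2 * n" by simp
      then have "(8::real) ^ (Suc n + Suc n) = 64 * 64 ^ n"
        by (simp only: power_add power_mult) simp
      then show ?thesis by (simp only: power_mult_distrib) simp
    qed
    finally show "(\<Sum>w\<in>sc_words n. \<Sum>j<8. ?b w i j) \<le> 64 * B / \<rho> ^ n" .
  qed
  finally have b: "(\<Sum>w\<in>sc_words n. \<Sum>j<8. \<Sum>i<8. ?b w i j) \<le> 512 * B / \<rho> ^ n" by simp
  have "sc_D n v \<le> (\<Sum>w\<in>sc_words n. 24 * (\<Sum>i<8. ?a w i) + 3/2 * (\<Sum>j<8. \<Sum>i<8. ?b w i j))"
    unfolding sc_D_eq by (intro sum_mono energy)
  also have "\<dots> = 24 * (\<Sum>w\<in>sc_words n. \<Sum>i<8. ?a w i) + 3/2 * (\<Sum>w\<in>sc_words n. \<Sum>j<8. \<Sum>i<8. ?b w i j)"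
    by (simp only: sum.distrib sum_distrib_left)
  also have "\<dots> \<le> 24 * (100352 * B / \<rho> ^ n) + 3/2 * (512 * B / \<rho> ^ n)"
    using sum_vertex_mean_le[OF v \<rho> B0 B n] b by (intro add_mono mult_left_mono) auto
  also have "\<dots> = 2409216 * B / \<rho> ^ n" by simp
  finally show ?thesis .
qed

lemma sup_energy_le_besov_seminorm:
  assumes v: "continuous_on carpet v" and \<rho>: "7/6 \<le> \<rho>"
  shows "sup_energy (beta_star \<rho>) v \<le> ennreal 2409216 * besov_seminorm (beta_star \<rho>) v"
proof (cases "besov_seminorm (beta_star \<rho>) v")
  case top
  then show ?thesis by (simp add: ennreal_mult_top)
next
  case (real B)
  have "ennreal (\<rho> ^ n * sc_D n v) \<le> ennreal (2409216 * B)" if n: "n \<ge> 1" for n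
  proof (rule ennreal_leI)
    show "\<rho> ^ n * sc_D n v \<le> 2409216 * B"
      using sc_D_le_besov[OF v \<rho> real(1) _ n] real(2) \<rho> by (simp add: field_simps)
  qed
  then show ?thesis
    using \<rho> real by (subst sup_energy_eq) (auto intro!: SUP_least simp: ennreal_mult)
qed

end

section \<open>Comparison with the Dirichlet form\<close>

lemma besov_seminorm_cong_AE:
  assumes "AE x in sc_nu. u x = v x"
  shows "besov_seminorm \<beta> u = besov_seminorm \<beta> v"
proof -
  have "(\<integral>\<^sup>+x. (\<integral>\<^sup>+y. ennreal ((u x - u y)\<^sup>2) * indicator (ball x ((1/3) ^ n)) y \<partial>sc_nu) \<partial>sc_nu)
      = (\<integral>\<^sup>+x. (\<integral>\<^sup>+y. ennreal ((v x - v y)\<^sup>2) * indicator (ball x ((1/3) ^ n)) y \<partial>sc_nu) \<partial>sc_nu)" for n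
  proof (rule nn_integral_cong_AE)
    show "AE x in sc_nu. (\<integral>\<^sup>+y. ennreal ((u x - u y)\<^sup>2) * indicator (ball x ((1/3) ^ n)) y \<partial>sc_nu)
      = (\<integral>\<^sup>+y. ennreal ((v x - v y)\<^sup>2) * indicator (ball x ((1/3) ^ n)) y \<partial>sc_nu)"
      using assms
    proof eventually_elim
      case (elim x)
      show ?case
        by (rule nn_integral_cong_AE) (use assms elim in \<open>auto elim!: eventually_mono\<close>)
    qed
  qed
  then show ?thesis unfolding besov_seminorm_def by simp
qed

lemma carpet_sets: "carpet \<in> sets sc_nu"
  using sets.top[of sc_nu] by simp

text \<open>
  Normalising by a total mass of \<open>0\<close> or \<open>\<infinity>\<close> gives the null measure, by the conventions \<open>0 / 0 = 0\<close> and \<open>x / \<infinity> = 0\<close>.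
\<close>

lemma sc_nu_null:
  assumes "\<not> carpet_mass"
  shows "emeasure sc_nu carpet = 0"
  using assms emeasure_sc_nu[of carpet] by (auto simp: carpet_mass_def)

context
  fixes F E
  assumes form: "strongly_local_regular_dirichlet_form carpet sc_nu F E"
begin

interpretation strongly_local_regular_dirichlet_form carpet sc_nu F E by (rule form)

lemma form_AE_diagonal:
  assumes "u \<in> F" "v \<in> F" "AE x in sc_nu. u x = v x"
  shows "E u u = E v v"
  using form_AE[OF assms(1,2,1,3)] form_AE[OF assms(1,2,2,3)] symmetric[OF assms(1,2)]
  by (metis symmetric assms(1,2))

lemma null_form_zero:
  assumes "emeasure sc_nu carpet = 0" "u \<in> F"
  shows "E u u = 0"
proof -
  have "AE x in sc_nu. P x" for P
    using assms(1) by (intro AE_I[of _ _ carpet]) (auto simp: carpet_sets)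
  have "(\<lambda>x. 0 * u x + 0 * u x) \<in> F" by (rule domain_linear[OF assms(2,2)])
  moreover have "E (\<lambda>x. 0 * u x + 0 * u x) u = 0 * E u u + 0 * E u u"
    by (rule linear[OF assms(2,2,2)])
  ultimately show ?thesis
    using form_AE[OF assms(2) _ assms(2), of "\<lambda>x. 0 * u x + 0 * u x"] \<open>\<And>P. AE x in sc_nu. P x\<close> by simp
qed

end

theorem theorem2p7:
  fixes \<rho> :: real
    and F_loc :: "(real \<times> real \<Rightarrow> real) set"
    and E_loc :: "(real \<times> real \<Rightarrow> real) \<Rightarrow> (real \<times> real \<Rightarrow> real) \<Rightarrow> real"
  assumes rho: "resistance_growth \<rho>" "7/6 \<le> \<rho>" "\<rho> \<le> 3/2"
    and form: "strongly_local_regular_dirichlet_form carpet sc_nu F_loc E_loc"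
    and self_similar: "self_similar_form \<rho> F_loc E_loc"
    and domain: "F_loc = energy_domain (beta_star \<rho>)"
    and comparable: "\<exists>C\<^sub>0\<ge>1. \<forall>u\<in>F_loc. continuous_on carpet u \<longrightarrow>
          ennreal (1 / C\<^sub>0 * E_loc u u) \<le> sup_energy (beta_star \<rho>) u \<and>
          sup_energy (beta_star \<rho>) u \<le> ennreal (C\<^sub>0 * E_loc u u)"
  shows "F_loc = besov_space (beta_star \<rho>) \<and>
    (\<exists>C\<ge>1. \<forall>u\<in>F_loc.
       ennreal (1 / C) * besov_seminorm (beta_star \<rho>) u \<le> ennreal (E_loc u u) \<and>
       ennreal (E_loc u u) \<le> ennreal C * besov_seminorm (beta_star \<rho>) u)"
\<comment> \<open>in the first case \<open>\<nu>\<close> is the null measure and all objects degenerate\<close>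
proof (cases carpet_mass)
  case False
  then have null: "emeasure sc_nu carpet = 0" by (rule sc_nu_null)
  then have AE: "AE x in sc_nu. P x" for P
    by (intro AE_I[of _ _ carpet]) (auto simp: carpet_sets)
  have besov: "besov_seminorm (beta_star \<rho>) u = 0" for u
  proof -
    have "besov_seminorm (beta_star \<rho>) u = besov_seminorm (beta_star \<rho>) (\<lambda>_. 0)"
      by (rule besov_seminorm_cong_AE[OF AE])
    then show ?thesis by (simp add: besov_seminorm_def)
  qed
  have "sup_energy (beta_star \<rho>) (\<lambda>_. 0) = 0"
    by (simp add: sup_energy_def sc_D_def)
  then have "F_loc = L2_space sc_nu"
    using AE by (auto simp: domain energy_domain_def intro!: exI[of _ "\<lambda>_. 0"])
  moreover have "besov_space (beta_star \<rho>) = L2_space sc_nu"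
    by (simp add: besov_space_def besov)
  moreover have "E_loc u u = 0" if "u \<in> F_loc" for u
    by (rule null_form_zero[OF form null that])
  ultimately show ?thesis by (auto simp: besov intro!: exI[of _ 1])
next
  case True
  interpret carpet_mass by (rule True)
  let ?\<beta> = "beta_star \<rho>"
  have \<rho>1: "1 < \<rho>" "1 \<le> \<rho>" using rho(2) by simp_all
  have L2: "F_loc \<subseteq> L2_space sc_nu" by (auto simp: domain energy_domain_def)
  have version: "\<exists>v. v \<in> F_loc \<and> continuous_on carpet v \<and> (AE x in sc_nu. u x = v x) \<and> sup_energy ?\<beta> v < \<infinity>"
    if u: "u \<in> F_loc" for u
  proof -
    obtain v where v: "continuous_on carpet v" "AE x in sc_nu. u x = v x" "sup_energy ?\<beta> v < \<infinity>"
      using u unfolding domain energy_domain_def by blast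
    have "v \<in> F_loc"
      unfolding domain energy_domain_def using v continuous_in_L2_space[OF v(1)] by auto
    with v show ?thesis by blast
  qed
  have "F_loc = besov_space ?\<beta>"
  proof
    show "F_loc \<subseteq> besov_space ?\<beta>"
    proof
      fix u assume u: "u \<in> F_loc"
      obtain v where v: "continuous_on carpet v" "AE x in sc_nu. u x = v x" "sup_energy ?\<beta> v < \<infinity>"
        using version[OF u] by blast
      have "besov_seminorm ?\<beta> u = besov_seminorm ?\<beta> v" by (rule besov_seminorm_cong_AE[OF v(2)])
      also have "\<dots> \<le> ennreal 4159512 * sup_energy ?\<beta> v" by (rule besov_seminorm_le_sup_energy[OF v(1) \<rho>1(2)])
      also have "\<dots> < \<infinity>" using v(3) by (simp add: ennreal_mult_less_top)
      finally show "u \<in> besov_space ?\<beta>" using u L2 by (auto simp: besov_space_def)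
    qed
    show "besov_space ?\<beta> \<subseteq> F_loc"
    proof
      fix u assume u: "u \<in> besov_space ?\<beta>"
      then have u': "u \<in> L2_space sc_nu" "besov_seminorm ?\<beta> u < \<infinity>" by (auto simp: besov_space_def)
      obtain v where v: "continuous_on carpet v" "AE x in sc_nu. u x = v x"
        using besov_continuous_version[OF u'(1) \<rho>1(1) u'(2)] by blast
      have "sup_energy ?\<beta> v \<le> ennreal 2409216 * besov_seminorm ?\<beta> v"
        by (rule sup_energy_le_besov_seminorm[OF v(1) rho(2)])
      also have "\<dots> < \<infinity>" using u'(2) besov_seminorm_cong_AE[OF v(2)] by (simp add: ennreal_mult_less_top)
      finally show "u \<in> F_loc" unfolding domain energy_domain_def using u'(1) v by blast
    qed
  qed
  moreover obtain C\<^sub>0 where C0: "C\<^sub>0 \<ge> 1" and cmp: "\<And>u. u \<in> F_loc \<Longrightarrow> continuous_on carpet u \<Longrightarrow>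
        ennreal (1 / C\<^sub>0 * E_loc u u) \<le> sup_energy ?\<beta> u \<and> sup_energy ?\<beta> u \<le> ennreal (C\<^sub>0 * E_loc u u)"
    using comparable by blast
  define C where "C = 4159512 * C\<^sub>0"
  have C1: "C \<ge> 1" using C0 by (simp add: C_def)
  have "ennreal (1 / C) * besov_seminorm ?\<beta> u \<le> ennreal (E_loc u u) \<and> ennreal (E_loc u u) \<le> ennreal C * besov_seminorm ?\<beta> u"
    if u: "u \<in> F_loc" for u
  proof -
    obtain v where v: "v \<in> F_loc" "continuous_on carpet v" "AE x in sc_nu. u x = v x"
      using version[OF u] by blast
    have B: "besov_seminorm ?\<beta> u = besov_seminorm ?\<beta> v" by (rule besov_seminorm_cong_AE[OF v(3)])
    have E: "E_loc u u = E_loc v v" by (rule form_AE_diagonal[OF form u v(1,3)])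
    note c = cmp[OF v(1,2)]
    have "besov_seminorm ?\<beta> v \<le> ennreal 4159512 * sup_energy ?\<beta> v" by (rule besov_seminorm_le_sup_energy[OF v(2) \<rho>1(2)])
    also have "\<dots> \<le> ennreal 4159512 * ennreal (C\<^sub>0 * E_loc v v)" using c by (intro mult_left_mono) auto
    also have "\<dots> = ennreal C * ennreal (E_loc v v)"
      using C0 by (simp add: C_def ennreal_mult' mult.assoc del: ennreal_numeral)
    finally have "ennreal (1 / C) * besov_seminorm ?\<beta> v \<le> ennreal (1 / C) * (ennreal C * ennreal (E_loc v v))"
      by (intro mult_left_mono) auto
    also have "\<dots> = ennreal (1 / C * C * E_loc v v)"
      using C1 by (simp only: mult.assoc) (simp add: ennreal_mult'[symmetric])
    also have "1 / C * C * E_loc v v = E_loc v v" using C1 by simp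
    finally have 1: "ennreal (1 / C) * besov_seminorm ?\<beta> v \<le> ennreal (E_loc v v)" .
    have "ennreal (E_loc v v) = ennreal C\<^sub>0 * ennreal (1 / C\<^sub>0 * E_loc v v)"
      using C0 by (subst ennreal_mult'[symmetric]) simp_all
    also have "\<dots> \<le> ennreal C\<^sub>0 * (ennreal 2409216 * besov_seminorm ?\<beta> v)"
      using c sup_energy_le_besov_seminorm[OF v(2) rho(2)] by (intro mult_left_mono) (auto intro: order_trans)
    also have "\<dots> = ennreal (C\<^sub>0 * 2409216) * besov_seminorm ?\<beta> v"
      using C0 by (simp only: mult.assoc[symmetric]) (simp add: ennreal_mult' del: ennreal_numeral)
    also have "\<dots> \<le> ennreal C * besov_seminorm ?\<beta> v"
      using C0 by (intro mult_right_mono ennreal_leI) (simp_all add: C_def)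
    finally show ?thesis using 1 B E by simp
  qed
  ultimately show ?thesis using C1 by blast
qed

end
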